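(* Let $\Delta$ be a simplicial tree with facets $F_0,\ldots,F_q$ that can be partitioned into subcollections $\Delta_0,\ldots,\Delta_s$, each of which is a simplicial tree, such that for some integers $0=a_0<a_1<\cdots<a_s<a_{s+1}=q+1$ the following hold for each $i=0,\ldots,s$: 1. $\Delta_i=\langle F_{a_i},F_{a_i+1},\ldots,F_{a_{i+1}-1}\rangle$ with good leaf $F_{a_i}$; 2. $F_{a_i},F_{a_i+1},\ldots,F_{a_{i+1}-1}$ is a good leaf order on $\Delta_i$, with $F_{a_i+1}\cap F_{a_i}\supseteq\cdots\supseteq F_{a_{i+1}-1}\cap F_{a_i}\neq\emptyset$; 3. $F_{a_i}\cap F_j=\emptyset$ for all $j\ge a_{i+1}$. Then for all $i,j\ge 0$ $$\beta_{i,j}(\Delta)\ \ge\ \beta_{i,j}(\Delta_0)+\cdots+\beta_{i,j}(\Delta_s).$$ In particular $$\mathrm{projdim}(\Delta)\ge\max\{\mathrm{projdim}(\Delta_0),\ldots,\mathrm{projdim}(\Delta_s)\}\quad\text{and}\quad \mathrm{reg}(\Delta)\ge\max\{\mathrm{reg}(\Delta_0),\ldots,\mathrm{reg}(\Delta_s)\}.$$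
   Context: A simplicial complex $\Delta$ on a finite vertex set is a collection of subsets (faces) containing all singletons and closed under taking subsets; its maximal faces are its facets. $\langle F_1,\ldots,F_r\rangle$ denotes the simplicial complex with facets $F_1,\ldots,F_r$. A subcollection of $\Delta$ is a simplicial complex whose facets are also facets of $\Delta$. $\Delta$ is connected if any two facets are joined by a sequence of facets with consecutive ones intersecting. A facet $F$ of $\Delta$ is a leaf if either $F$ is the only facet of $\Delta$, or there is a facet $G\ne F$ of $\Delta$ (a joint of $F$) with $F\cap H\subseteq G$ for all facets $H\neq F$ of $\Delta$. A simplicial forest is a simplicial complex in which every nonempty subcollection has a leaf; a simplicial tree is a connected simplicial forest. A good leaf of $\Delta$ is a facet that is a leaf of every subcollection of $\Delta$ containing it. For a good leaf $G_0$ of a tree $\Gamma$, a good leaf order on $\Gamma$ is an ordering $G_0,G_1,\ldots,G_p$ of all its facets with $G_0\cap G_1\supseteq\cdots\supseteq G_0\cap G_p$ and such that $G_i$ is a leaf of $\langle G_0,\ldots,G_i\rangle$ for every $i\le p$. Let $k$ be a field and $R$ the polynomial ring over $k$ with variables the vertices of $\Delta$. The facet ideal $\mathcal{F}(\Gamma)$ of a subcollection $\Gamma$ is the ideal of $R$ generated by the monomials $\prod_{x\in F}x$, $F$ a facet of $\Gamma$. For a graded ideal $I$, $\beta_{i,j}(I)$ is the $\mathbb{N}$-graded Betti number: the number of copies of $R(-j)$ in homological degree $i$ of the minimal graded free resolution $\cdots\to\bigoplus_d R(-d)^{\beta_{0,d}}\to I\to 0$ of $I$. $\mathrm{reg}(I)$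 is the maximum of $j-i$ with $\beta_{i,j}(I)\ne0$, and $\mathrm{projdim}(I)$ is the maximum $i$ with $\beta_{i,j}(I)\neq 0$ for some $j$. One writes $\beta_{i,j}(\Gamma)$, $\mathrm{reg}(\Gamma)$, $\mathrm{projdim}(\Gamma)$ for those of $\mathcal{F}(\Gamma)$. *)

theory Defs
  imports
    "HOL-Library.Poly_Mapping"
    "Jordan_Normal_Form.Matrix_Kernel"
begin

section \<open>Simplicial trees\<close>

definition simplicial_complex_on :: "'v set \<Rightarrow> 'v set set \<Rightarrow> bool" where
  "simplicial_complex_on V \<Delta> \<longleftrightarrow>
     finite V \<and> \<Delta> \<subseteq> Pow V \<and> (\<forall>v\<in>V. {v} \<in> \<Delta>) \<and> (\<forall>F\<in>\<Delta>. \<forall>G\<subseteq>F. G \<in> \<Delta>)"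

definition facets :: "'v set set \<Rightarrow> 'v set set" where
  "facets \<Delta> = {F \<in> \<Delta>. \<forall>G\<in>\<Delta>. F \<subseteq> G \<longrightarrow> G = F}"

text \<open>The complex \<open>\<langle>F\<^sub>1,\<dots>,F\<^sub>r\<rangle>\<close>. Its facets are \<open>F\<^sub>1,\<dots>,F\<^sub>r\<close> when no \<open>F\<^sub>i\<close> contains another,
  in particular when they are facets of a common complex.\<close>

definition generated_complex :: "'v set set \<Rightarrow> 'v set set" where
  "generated_complex S = {G. \<exists>F\<in>S. G \<subseteq> F}"

text \<open>The vertex set of a complex \<open>\<Gamma>\<close> is always \<open>\<Union>\<Gamma>\<close>, so that a subcollection may have fewer
  vertices than the ambient complex.\<close>

definition subcollection :: "'v set set \<Rightarrow> 'v set set \<Rightarrow> bool" where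
  "subcollection \<Gamma> \<Delta> \<longleftrightarrow> simplicial_complex_on (\<Union>\<Gamma>) \<Gamma> \<and> facets \<Gamma> \<subseteq> facets \<Delta>"

definition connected_complex :: "'v set set \<Rightarrow> bool" where
  "connected_complex \<Delta> \<longleftrightarrow>
     (\<forall>F\<in>facets \<Delta>. \<forall>G\<in>facets \<Delta>.
        (F, G) \<in> {(A, B). A \<in> facets \<Delta> \<and> B \<in> facets \<Delta> \<and> A \<inter> B \<noteq> {}}\<^sup>*)"

definition leaf :: "'v set \<Rightarrow> 'v set set \<Rightarrow> bool" where
  "leaf F \<Delta> \<longleftrightarrow> F \<in> facets \<Delta> \<and>
     (facets \<Delta> = {F} \<or>
      (\<exists>G\<in>facets \<Delta>. G \<noteq> F \<and> (\<forall>H\<in>facets \<Delta>. H \<noteq> F \<longrightarrow> F \<inter> H \<subseteq> G)))"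

definition simplicial_forest :: "'v set set \<Rightarrow> bool" where
  "simplicial_forest \<Delta> \<longleftrightarrow> simplicial_complex_on (\<Union>\<Delta>) \<Delta> \<and>
     (\<forall>\<Gamma>. subcollection \<Gamma> \<Delta> \<and> \<Gamma> \<noteq> {} \<longrightarrow> (\<exists>F. leaf F \<Gamma>))"

definition simplicial_tree :: "'v set set \<Rightarrow> bool" where
  "simplicial_tree \<Delta> \<longleftrightarrow> simplicial_forest \<Delta> \<and> connected_complex \<Delta>"

definition good_leaf :: "'v set \<Rightarrow> 'v set set \<Rightarrow> bool" where
  "good_leaf F \<Delta> \<longleftrightarrow> F \<in> facets \<Delta> \<and> (\<forall>\<Gamma>. subcollection \<Gamma> \<Delta> \<and> F \<in> \<Gamma> \<longrightarrow> leaf F \<Gamma>)"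

definition good_leaf_order :: "'v set list \<Rightarrow> 'v set set \<Rightarrow> bool" where
  "good_leaf_order Gs \<Gamma> \<longleftrightarrow>
     Gs \<noteq> [] \<and> distinct Gs \<and> set Gs = facets \<Gamma> \<and> good_leaf (Gs ! 0) \<Gamma> \<and>
     (\<forall>i j. 1 \<le> i \<longrightarrow> i \<le> j \<longrightarrow> j < length Gs \<longrightarrow> Gs ! 0 \<inter> Gs ! j \<subseteq> Gs ! 0 \<inter> Gs ! i) \<and>
     (\<forall>i<length Gs. leaf (Gs ! i) (generated_complex (set (take (Suc i) Gs))))"

section \<open>Graded free resolutions over the polynomial ring\<close>

text \<open>A monomial is its exponent vector, and the variables are all elements of \<open>'v\<close>. A polynomial
  ring on exactly the vertices of a complex is obtained by letting \<open>'v\<close> be a finite type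
  all of whose elements are vertices.\<close>

type_synonym ('v, 'k) mpoly = "('v \<Rightarrow>\<^sub>0 nat) \<Rightarrow>\<^sub>0 'k"

definition mon_degree :: "('v \<Rightarrow>\<^sub>0 nat) \<Rightarrow> nat" where
  "mon_degree m = (\<Sum>x\<in>Poly_Mapping.keys m. Poly_Mapping.lookup m x)"

text \<open>A list \<open>ds\<close> of shifts stands for the graded free module \<open>\<Oplus>\<^sub>c R(-ds!c)\<close>, with underlying module
  \<open>carrier_vec (length ds)\<close>. Its component of degree \<open>e\<close> consists of the vectors whose
  coordinate \<open>c\<close> lies in \<open>R(-ds!c)\<^sub>e\<close>, the forms of degree \<open>e - ds!c\<close>.\<close>

definition graded_component :: "nat list \<Rightarrow> nat \<Rightarrow> ('v, 'k::comm_ring_1) mpoly vec set" where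
  "graded_component ds e =
     {v \<in> carrier_vec (length ds).
        \<forall>c<length ds. \<forall>m\<in>Poly_Mapping.keys (v $ c). mon_degree m + ds ! c = e}"

text \<open>Homogeneous homomorphisms of degree 0, as matrices acting on column vectors.\<close>

definition graded_hom ::
  "nat list \<Rightarrow> nat list \<Rightarrow> ('v, 'k::comm_ring_1) mpoly mat \<Rightarrow> bool" where
  "graded_hom ds es A \<longleftrightarrow> A \<in> carrier_mat (length es) (length ds) \<and>
     (\<forall>e. \<forall>v\<in>graded_component ds e. A *\<^sub>v v \<in> graded_component es e)"

definition mat_image :: "'a::comm_ring_1 mat \<Rightarrow> 'a vec set" where
  "mat_image A = (\<lambda>v. A *\<^sub>v v) ` carrier_vec (dim_col A)"

text \<open>In homological degree \<open>i\<close> the resolution has the module \<open>F\<^sub>i\<close> with shifts \<open>ds i\<close>. The map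
  \<open>\<phi> 0\<close> is the augmentation from \<open>F\<^sub>0\<close> onto \<open>I \<subseteq> R\<close>, where \<open>R\<close> is free on one generator of
  degree 0, and \<open>\<phi> (Suc i)\<close> maps \<open>F\<^bsub>i+1\<^esub>\<close> to \<open>F\<^sub>i\<close>. The last condition, that constant terms of matrix
  entries vanish, is minimality: the image of \<open>\<phi> (Suc i)\<close> lies in \<open>\<mm> F\<^sub>i\<close>, where \<open>\<mm>\<close> is generated
  by the variables.\<close>

definition minimal_graded_free_resolution ::
  "('v, 'k::comm_ring_1) mpoly set \<Rightarrow> (nat \<Rightarrow> nat list) \<Rightarrow> (nat \<Rightarrow> ('v, 'k) mpoly mat) \<Rightarrow> bool"
  where
  "minimal_graded_free_resolution I ds \<phi> \<longleftrightarrow>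
     graded_hom (ds 0) [0] (\<phi> 0) \<and>
     (\<forall>i. graded_hom (ds (Suc i)) (ds i) (\<phi> (Suc i))) \<and>
     mat_image (\<phi> 0) = {v \<in> carrier_vec 1. v $ 0 \<in> I} \<and>
     (\<forall>i. mat_image (\<phi> (Suc i)) = mat_kernel (\<phi> i)) \<and>
     (\<forall>i. \<forall>r<length (ds i). \<forall>c<length (ds (Suc i)).
        Poly_Mapping.lookup (\<phi> (Suc i) $$ (r, c)) 0 = 0)"

text \<open>The minimal graded free resolution is unique up to isomorphism, so the number of
  summands \<open>R(-j)\<close> does not depend on its choice.\<close>

definition betti :: "('v, 'k::field) mpoly set \<Rightarrow> nat \<Rightarrow> nat \<Rightarrow> nat" where
  "betti I i j = (THE n. \<exists>ds \<phi>. minimal_graded_free_resolution I ds \<phi> \<and> n = count_list (ds i) j)"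

definition projdim :: "('v, 'k::field) mpoly set \<Rightarrow> nat" where
  "projdim I = Max {i. \<exists>j. betti I i j \<noteq> 0}"

definition reg :: "('v, 'k::field) mpoly set \<Rightarrow> int" where
  "reg I = Max {int j - int i | i j. betti I i j \<noteq> 0}"

definition facet_monomial :: "'v set \<Rightarrow> ('v, 'k::field) mpoly" where
  "facet_monomial F = (\<Prod>x\<in>F. Poly_Mapping.single (Poly_Mapping.single x 1) 1)"

text \<open>Ideals are the submodules of \<open>R\<close> as a module over itself.\<close>

definition facet_ideal :: "'k::field itself \<Rightarrow> 'v set set \<Rightarrow> ('v, 'k) mpoly set" where
  "facet_ideal _ \<Gamma> = Modules.module.span (*) (facet_monomial ` facets \<Gamma>)"

end

theory Submission
  imports Defs "HOL-Library.Function_Algebras"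
begin

text \<open>The Betti numbers of a squarefree monomial ideal refine to multigraded ones, indexed by
  vertex sets \<open>W\<close>. The Betti number at \<open>W\<close> depends only on the facets contained in \<open>W\<close>, and it
  vanishes unless \<open>W\<close> is a nonempty union of facets. Let \<open>W\<close> be such a union of facets of
  \<open>\<Delta>\<^sub>t\<close>. All these facets contain the nonempty set \<open>C\<^sub>t\<close>, the intersection of the first and the
  last facet of \<open>\<Delta>\<^sub>t\<close>. A facet \<open>H \<subseteq> W\<close> of an earlier \<open>\<Delta>\<^sub>u\<close> would contain \<open>C\<^sub>u\<close>, which is
  disjoint from \<open>W\<close>. A facet \<open>H \<subseteq> W\<close> of a later \<open>\<Delta>\<^sub>u\<close> misses \<open>C\<^sub>t\<close>; as a forest has no special
  triangle \<open>G, G', H\<close> through \<open>C\<^sub>t\<close>, the traces on \<open>H\<close> of the facets of \<open>\<Delta>\<^sub>t\<close> in \<open>W\<close> form a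
  chain, so that one of them contains \<open>H\<close>, which is absurd. Hence \<open>\<Delta>\<close> and \<open>\<Delta>\<^sub>t\<close> have the same
  facets inside \<open>W\<close>, therefore the same Betti numbers at \<open>W\<close>, and the supports of the
  multigraded Betti numbers of the \<open>\<Delta>\<^sub>t\<close> are disjoint.

  The refinement comes from a minimal resolution whose matrix entries are scalars times
  monomials. It is exact if and only if its scalar parts are exact on the basis elements with
  label contained in \<open>W\<close>, for every \<open>W\<close>; so it can be built by choosing a complement of the
  kernel vectors that come from smaller labels, and discarding the labels not contained in \<open>W\<close>
  leaves a minimal resolution. That the Betti numbers can be read off from any minimal resolution
  follows by comparing two of them: the composition of comparison maps is homotopic to the
  identity, and homotopies die modulo the variables.\<close>

section \<open>Minimal syzygies in multigraded linear algebra\<close>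

text \<open>A basis of \<open>N\<close> extends to one of \<open>K\<close>, and the added vectors
  form \<open>X\<close>. In the application \<open>K\<close> holds the syzygies of a multidegree and
  \<open>N\<close> those generated in smaller multidegrees, so \<open>X\<close> is a minimal set of
  new generators.\<close>

lemma (in Vector_Spaces.vector_space) complement_basis:
  assumes K: "subspace K" and N: "subspace N" "N \<subseteq> K" and Y: "finite Y" "K \<subseteq> span Y"
  shows "\<exists>X. X \<subseteq> K \<and> finite X \<and>
    (\<forall>u. (\<Sum>x\<in>X. scale (u x) x) \<in> N \<longrightarrow> (\<forall>x\<in>X. u x = 0)) \<and>
    (\<forall>v\<in>K. \<exists>u. v - (\<Sum>x\<in>X. scale (u x) x) \<in> N)"
proof -
  obtain B0 where B0: "B0 \<subseteq> N" "independent B0" "N \<subseteq> span B0"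
    using maximal_independent_subset by blast
  obtain B1 where B1: "B0 \<subseteq> B1" "B1 \<subseteq> K" "independent B1" "K \<subseteq> span B1"
    using maximal_independent_subset_extend[of B0 K] B0 N by blast
  have fin1: "finite B1"
    using independent_span_bound[OF Y(1) B1(3)] B1(2) Y(2) by blast
  then have fin0: "finite B0" and finX: "finite (B1 - B0)"
    using B1(1) finite_subset by auto
  show ?thesis
  proof (intro exI[of _ "B1 - B0"] conjI allI impI ballI)
    fix u x assume s: "(\<Sum>x\<in>B1 - B0. scale (u x) x) \<in> N" and x: "x \<in> B1 - B0"
    then have "(\<Sum>x\<in>B1 - B0. scale (u x) x) \<in> span B0" using B0(3) by blast
    then obtain w where w: "(\<Sum>x\<in>B1 - B0. scale (u x) x) = (\<Sum>b\<in>B0. scale (w b) b)"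
      unfolding span_finite[OF fin0] by blast
    \<comment> \<open>A relation among the vectors of \<open>X\<close> modulo \<open>N\<close>
      becomes one among the whole basis \<open>B1\<close>, with the \<open>B0\<close>-part moved
      across.\<close>
    let ?g = "\<lambda>b. if b \<in> B0 then - w b else u b"
    have "(\<Sum>b\<in>B1. scale (?g b) b)
        = (\<Sum>b\<in>B1 - B0. scale (?g b) b) + (\<Sum>b\<in>B0. scale (?g b) b)"
      using sum.subset_diff[OF B1(1) fin1] by blast
    also have "(\<Sum>b\<in>B1 - B0. scale (?g b) b) = (\<Sum>b\<in>B1 - B0. scale (u b) b)"
      by (rule sum.cong) auto
    also have "(\<Sum>b\<in>B0. scale (?g b) b) = - (\<Sum>b\<in>B0. scale (w b) b)"
      unfolding sum_negf[symmetric] by (rule sum.cong) auto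
    finally have "(\<Sum>b\<in>B1. scale (?g b) b) = 0" using w by simp
    from independentD[OF B1(3) fin1 order_refl this, of x] x show "u x = 0" by auto
  next
    fix v assume "v \<in> K"
    then have "v \<in> span B1" using B1(4) by blast
    then obtain u where u: "v = (\<Sum>b\<in>B1. scale (u b) b)"
      unfolding span_finite[OF fin1] by blast
    have "v = (\<Sum>b\<in>B1 - B0. scale (u b) b) + (\<Sum>b\<in>B0. scale (u b) b)"
      unfolding u using sum.subset_diff[OF B1(1) fin1] by blast
    moreover have "(\<Sum>b\<in>B0. scale (u b) b) \<in> N"
      by (rule subspace_sum[OF N(1)], rule subspace_scale[OF N(1)]) (use B0 in auto)
    ultimately show "\<exists>u. v - (\<Sum>x\<in>B1 - B0. scale (u x) x) \<in> N"
      by (intro exI[of _ u]) simp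
  qed (use B1 finX in auto)
qed

definition fun_scale :: "'k::field \<Rightarrow> ('b \<Rightarrow> 'k) \<Rightarrow> 'b \<Rightarrow> 'k" where
  "fun_scale a f = (\<lambda>x. a * f x)"

interpretation fun_vs: Vector_Spaces.vector_space fun_scale
  by unfold_locales (auto simp: fun_scale_def algebra_simps fun_eq_iff)

lemma sum_fun_scale: "(\<Sum>x\<in>X. fun_scale (u x) (f x)) c = (\<Sum>x\<in>X. u x * f x c)"
  by (induction X rule: infinite_finite_induct) (auto simp: fun_scale_def)

lemma supported_in_span_units:
  fixes v :: "'b \<Rightarrow> 'k::field"
  assumes fin: "finite C" and v: "\<And>c. v c \<noteq> 0 \<Longrightarrow> c \<in> C"
  shows "v \<in> fun_vs.span ((\<lambda>c x. if x = c then 1 else 0) ` C)"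
proof -
  have "v = (\<Sum>c\<in>C. fun_scale (v c) (\<lambda>x. if x = c then 1 else 0))"
  proof
    fix x
    have "(\<Sum>c\<in>C. v c * (if x = c then 1 else 0)) = (\<Sum>c\<in>C. if x = c then v c else 0)"
      by (rule sum.cong) auto
    then show "v x = (\<Sum>c\<in>C. fun_scale (v c) (\<lambda>x. if x = c then 1 else 0)) x"
      unfolding sum_fun_scale using v[of x] fin by auto
  qed
  then show ?thesis
    by (metis (no_types, lifting) fun_vs.span_base fun_vs.span_scale fun_vs.span_sum image_eqI)
qed

text \<open>A left inverse makes the columns of \<open>p\<close> linearly independent in a space of
  dimension \<open>card R\<close>.\<close>

lemma card_le_if_left_inverse:
  fixes p :: "'r \<Rightarrow> 'c \<Rightarrow> 'k::field"
  assumes finR: "finite R" and finC: "finite C"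
    and inv: "\<And>c c'. c \<in> C \<Longrightarrow> c' \<in> C \<Longrightarrow> (\<Sum>r\<in>R. g c r * p r c') = (if c = c' then 1 else 0)"
  shows "card C \<le> card R"
proof -
  \<comment> \<open>Columns are cut off outside \<open>R\<close>, so that they lie in the span of
    finitely many unit vectors.\<close>
  define f where "f c = (\<lambda>r. if r \<in> R then p r c else 0)" for c
  have pick: "(\<Sum>r\<in>R. g c r * f c' r) = (if c = c' then 1 else 0)" if "c \<in> C" "c' \<in> C" for c c'
    using inv[OF that] by (simp add: f_def)
  have inj: "inj_on f C"
  proof (rule inj_onI)
    fix c c' assume c: "c \<in> C" "c' \<in> C" and eq: "f c = f c'"
    show "c = c'"
      using pick[OF c(1,1)] pick[OF c] unfolding eq by (metis one_neq_zero)
  qed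
  have ind: "fun_vs.independent (f ` C)"
    unfolding fun_vs.dependent_finite[OF finite_imageI[OF finC]]
  proof safe
    fix u c assume s: "(\<Sum>v\<in>f ` C. fun_scale (u v) v) = 0" and c: "c \<in> C" and nz: "u (f c) \<noteq> 0"
    \<comment> \<open>Pairing with row \<open>c\<close> of \<open>g\<close> isolates the coefficient
      of \<open>f c\<close>.\<close>
    have "0 = (\<Sum>r\<in>R. g c r * (\<Sum>v\<in>f ` C. fun_scale (u v) v) r)" by (simp add: s)
    also have "\<dots> = (\<Sum>r\<in>R. g c r * (\<Sum>c'\<in>C. u (f c') * f c' r))"
      by (subst sum.reindex[OF inj]) (simp add: sum_fun_scale[of _ f])
    also have "\<dots> = (\<Sum>c'\<in>C. u (f c') * (\<Sum>r\<in>R. g c r * f c' r))"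
      unfolding sum_distrib_left by (subst sum.swap) (simp add: mult.left_commute)
    also have "\<dots> = (\<Sum>c'\<in>C. if c = c' then u (f c') else 0)"
      by (rule sum.cong) (auto simp: pick c)
    also have "\<dots> = u (f c)" using finC c by simp
    finally show False using nz by simp
  qed
  have "f ` C \<subseteq> fun_vs.span ((\<lambda>c x. if x = c then 1 else 0) ` R)"
  proof safe
    fix c show "f c \<in> fun_vs.span ((\<lambda>c x. if x = c then 1 else 0) ` R)"
      by (rule supported_in_span_units[OF finR]) (auto simp: f_def split: if_splits)
  qed
  from fun_vs.independent_span_bound[OF finite_imageI[OF finR] ind this]
  have "card (f ` C) \<le> card R" using card_image_le[OF finR] le_trans by blast
  then show ?thesis using card_image[OF inj] by simp
qed

text \<open>Minimality in scalar form: no element of \<open>C\<close> is redundant, and the syzygies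
  of the next step have labels strictly larger than those of the elements they involve.\<close>

definition label_independent ::
  "('v set \<times> nat) set \<Rightarrow> ('v set \<times> nat) set \<Rightarrow> ('v set \<times> nat \<Rightarrow> 'v set \<times> nat \<Rightarrow> 'k::field) \<Rightarrow> bool"
  where "label_independent A C l \<longleftrightarrow>
    (\<forall>W v. (\<forall>c\<in>C. v c \<noteq> 0 \<longrightarrow> fst c \<subseteq> W) \<longrightarrow> (\<forall>b\<in>A. (\<Sum>c\<in>C. l b c * v c) = 0) \<longrightarrow>
       (\<forall>c\<in>C. fst c = W \<longrightarrow> v c = 0))"

text \<open>For each label \<open>W\<close> the syzygies \<open>K W\<close> have a subspace
  \<open>N W\<close> generated in smaller labels, and \<open>D\<close> collects bases of complements
  of all \<open>N W\<close>. Exactness follows by induction on \<open>W\<close>, independence of the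
  new columns from the complement property.\<close>

lemma minimal_syzygies:
  fixes A C :: "('v::finite set \<times> nat) set" and l :: "'v set \<times> nat \<Rightarrow> 'v set \<times> nat \<Rightarrow> 'k::field"
  assumes finC: "finite C" and ind: "label_independent A C l"
  shows "\<exists>D m. finite D \<and> label_independent C D m \<and>
    (\<forall>c\<in>C. \<forall>d\<in>D. m c d \<noteq> 0 \<longrightarrow> fst c \<subset> fst d) \<and>
    (\<forall>b\<in>A. \<forall>d\<in>D. (\<Sum>c\<in>C. l b c * m c d) = 0) \<and>
    (\<forall>W v. (\<forall>c\<in>C. v c \<noteq> 0 \<longrightarrow> fst c \<subseteq> W) \<longrightarrow> (\<forall>b\<in>A. (\<Sum>c\<in>C. l b c * v c) = 0) \<longrightarrow>
       (\<exists>u. (\<forall>d\<in>D. u d \<noteq> 0 \<longrightarrow> fst d \<subseteq> W) \<and> (\<forall>c\<in>C. v c = (\<Sum>d\<in>D. m c d * u d))))"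
proof -
  \<comment> \<open>Vectors vanish outside \<open>C\<close>, so that \<open>K W\<close> sits in a
    finite-dimensional space.\<close>
  define K where "K W = {v. (\<forall>c. v c \<noteq> 0 \<longrightarrow> c \<in> C \<and> fst c \<subseteq> W) \<and>
      (\<forall>b\<in>A. (\<Sum>c\<in>C. l b c * v c) = 0)}" for W
  define N where "N W = fun_vs.span (\<Union>W'\<in>{W'. W' \<subset> W}. K W')" for W
  have K_sub: "fun_vs.subspace (K W)" for W
  proof (rule fun_vs.subspaceI)
    show "0 \<in> K W" unfolding K_def by simp
  next
    fix x y assume "x \<in> K W" "y \<in> K W"
    then show "x + y \<in> K W"
      unfolding K_def by (simp add: distrib_left sum.distrib) (metis add_0)
  next
    fix k x assume "x \<in> K W"
    moreover have "(\<Sum>c\<in>C. l b c * fun_scale k x c) = k * (\<Sum>c\<in>C. l b c * x c)" for b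
      by (simp add: fun_scale_def sum_distrib_left mult.left_commute)
    ultimately show "fun_scale k x \<in> K W"
      unfolding K_def by (simp add: fun_scale_def) blast
  qed
  have N_sub: "fun_vs.subspace (N W)" for W
    unfolding N_def by simp
  have K_mono: "K W' \<subseteq> K W" if "W' \<subseteq> W" for W W'
    using that unfolding K_def by blast
  have N_le: "N W \<subseteq> K W" for W
    unfolding N_def by (rule fun_vs.span_minimal[OF _ K_sub]) (use K_mono in blast)
  have K_le: "K W \<subseteq> fun_vs.span ((\<lambda>c x. if x = c then 1 else 0) ` C)" for W
    using supported_in_span_units[OF finC] unfolding K_def by blast
  have "\<forall>W. \<exists>X. X \<subseteq> K W \<and> finite X \<and>
      (\<forall>u. (\<Sum>x\<in>X. fun_scale (u x) x) \<in> N W \<longrightarrow> (\<forall>x\<in>X. u x = 0)) \<and>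
      (\<forall>v\<in>K W. \<exists>u. v - (\<Sum>x\<in>X. fun_scale (u x) x) \<in> N W)"
    using fun_vs.complement_basis[OF K_sub N_sub N_le finite_imageI[OF finC] K_le] by blast
  from choice[OF this] obtain X where "\<forall>W. X W \<subseteq> K W \<and> finite (X W) \<and>
      (\<forall>u. (\<Sum>x\<in>X W. fun_scale (u x) x) \<in> N W \<longrightarrow> (\<forall>x\<in>X W. u x = 0)) \<and>
      (\<forall>v\<in>K W. \<exists>u. v - (\<Sum>x\<in>X W. fun_scale (u x) x) \<in> N W)" ..
  then have X: "X W \<subseteq> K W" "finite (X W)"
      "(\<Sum>x\<in>X W. fun_scale (u x) x) \<in> N W \<Longrightarrow> \<forall>x\<in>X W. u x = 0"
      "v \<in> K W \<Longrightarrow> \<exists>u. v - (\<Sum>x\<in>X W. fun_scale (u x) x) \<in> N W" for W u v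
    by simp_all
  have "\<exists>e. bij_betw e {0..<card (X W)} (X W)" for W
    using ex_bij_betw_nat_finite[OF X(2)] by blast
  then obtain e where e: "\<And>W. bij_betw (e W) {0..<card (X W)} (X W)" by metis
  \<comment> \<open>A new basis element is a label \<open>W\<close> with a number below the size of
    \<open>X W\<close>; its column in \<open>m\<close> is the vector of that number. As
    \<open>'v\<close> is finite, there are finitely many labels.\<close>
  define D where "D = (SIGMA W:UNIV. {0..<card (X W)})"
  define m where "m c d = e (fst d) (snd d) c" for c d
  have finD: "finite D" unfolding D_def by (rule finite_SigmaI) auto
  have finDW: "finite {d\<in>D. P d}" for P using finD by simp
  have mK: "(\<lambda>c. m c d) \<in> K (fst d)" if "d \<in> D" for d
    using that e[of "fst d"] X(1) unfolding D_def m_def bij_betw_def by fastforce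
  have sumX: "(\<Sum>d\<in>{d\<in>D. fst d = W}. fun_scale (v d) (\<lambda>c. m c d))
      = (\<Sum>x\<in>X W. fun_scale (v (W, the_inv_into {0..<card (X W)} (e W) x)) x)" for W v
  proof -
    have *: "{d\<in>D. fst d = W} = Pair W ` {0..<card (X W)}" unfolding D_def by auto
    have "(\<Sum>d\<in>{d\<in>D. fst d = W}. fun_scale (v d) (\<lambda>c. m c d))
        = (\<Sum>n\<in>{0..<card (X W)}. fun_scale (v (W, n)) (e W n))"
      unfolding * by (subst sum.reindex) (auto simp: inj_on_def m_def)
    also have "\<dots> = (\<Sum>n\<in>{0..<card (X W)}.
        (\<lambda>x. fun_scale (v (W, the_inv_into {0..<card (X W)} (e W) x)) x) (e W n))"
      using e[of W] by (intro sum.cong) (auto simp: bij_betw_def the_inv_into_f_f)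
    also have "\<dots> = (\<Sum>x\<in>X W. fun_scale (v (W, the_inv_into {0..<card (X W)} (e W) x)) x)"
      by (rule sum.reindex_bij_betw[OF e])
    finally show ?thesis .
  qed
  \<comment> \<open>Here independence of \<open>l\<close> enters: a syzygy in \<open>K W\<close>
    vanishes at the elements of label exactly \<open>W\<close>.\<close>
  have strict: "fst c \<subset> W" if "v \<in> K W" "v c \<noteq> 0" for v c W
    using ind that unfolding label_independent_def K_def by blast
  \<comment> \<open>\<open>T W\<close> is what the new columns with labels inside \<open>W\<close>
    generate; exactness is the inclusion \<open>K W \<subseteq> T W\<close>.\<close>
  define T where "T W = {v. \<exists>u. (\<forall>d. u d \<noteq> 0 \<longrightarrow> fst d \<subseteq> W) \<and>
      v = (\<Sum>d\<in>D. fun_scale (u d) (\<lambda>c. m c d))}" for W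
  have TI: "v \<in> T W" if "\<And>d. u d \<noteq> 0 \<Longrightarrow> fst d \<subseteq> W"
    "v = (\<Sum>d\<in>D. fun_scale (u d) (\<lambda>c. m c d))" for u v W
    unfolding T_def using that by (intro CollectI exI[of _ u]) simp
  have T_sub: "fun_vs.subspace (T W)" for W
  proof (rule fun_vs.subspaceI)
    show "0 \<in> T W" by (rule TI[of "\<lambda>_. 0"]) auto
  next
    fix x y assume "x \<in> T W" "y \<in> T W"
    then obtain u w where u: "\<forall>d. u d \<noteq> 0 \<longrightarrow> fst d \<subseteq> W" "\<forall>d. w d \<noteq> 0 \<longrightarrow> fst d \<subseteq> W"
      "x = (\<Sum>d\<in>D. fun_scale (u d) (\<lambda>c. m c d))" "y = (\<Sum>d\<in>D. fun_scale (w d) (\<lambda>c. m c d))"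
      unfolding T_def by blast
    show "x + y \<in> T W"
    proof (rule TI[of "\<lambda>d. u d + w d"])
      show "fst d \<subseteq> W" if "u d + w d \<noteq> 0" for d using u(1,2) that by (metis add_0)
      show "x + y = (\<Sum>d\<in>D. fun_scale (u d + w d) (\<lambda>c. m c d))"
        unfolding u(3,4) by (simp add: fun_vs.scale_left_distrib sum.distrib)
    qed
  next
    fix k x assume "x \<in> T W"
    then obtain u where u: "\<forall>d. u d \<noteq> 0 \<longrightarrow> fst d \<subseteq> W"
      "x = (\<Sum>d\<in>D. fun_scale (u d) (\<lambda>c. m c d))" unfolding T_def by blast
    show "fun_scale k x \<in> T W"
    proof (rule TI[of "\<lambda>d. k * u d"])
      show "fst d \<subseteq> W" if "k * u d \<noteq> 0" for d using u(1) that by (metis mult_zero_right)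
      show "fun_scale k x = (\<Sum>d\<in>D. fun_scale (k * u d) (\<lambda>c. m c d))"
        unfolding u(2) fun_vs.scale_sum_right fun_vs.scale_scale ..
    qed
  qed
  have T_mono: "T W' \<subseteq> T W" if "W' \<subseteq> W" for W W'
    using that unfolding T_def by blast
  have KT: "K W \<subseteq> T W" for W
  proof (induction W rule: finite_psubset_induct[OF finite])
    case (1 W)
    \<comment> \<open>By induction the syzygies of strictly smaller labels are already generated,
      hence so is their span.\<close>
    have NT: "N W \<subseteq> T W"
      unfolding N_def by (rule fun_vs.span_minimal[OF _ T_sub]) (use 1 T_mono in blast)
    show ?case
    proof
      fix v assume "v \<in> K W"
      then obtain u where u: "v - (\<Sum>x\<in>X W. fun_scale (u x) x) \<in> N W" using X(4) by blast
      let ?u = "\<lambda>d. if fst d = W then u (e W (snd d)) else 0"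
      have "(\<Sum>x\<in>X W. fun_scale (u x) x)
          = (\<Sum>x\<in>X W. fun_scale (?u (W, the_inv_into {0..<card (X W)} (e W) x)) x)"
        using e[of W] by (intro sum.cong) (auto simp: bij_betw_def f_the_inv_into_f)
      also have "\<dots> = (\<Sum>d\<in>{d\<in>D. fst d = W}. fun_scale (?u d) (\<lambda>c. m c d))"
        by (rule sumX[symmetric])
      also have "\<dots> = (\<Sum>d\<in>D. fun_scale (?u d) (\<lambda>c. m c d))"
        by (rule sum.mono_neutral_left) (use finD in auto)
      finally have "(\<Sum>x\<in>X W. fun_scale (u x) x) \<in> T W"
        by (rule TI[rotated]) (auto split: if_splits)
      then show "v \<in> T W"
        using fun_vs.subspace_add[OF T_sub, of "v - (\<Sum>x\<in>X W. fun_scale (u x) x)" W] u NT by fastforce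
    qed
  qed
  show ?thesis
  proof (intro exI[of _ D] exI[of _ m] conjI ballI impI allI)
    show "finite D" by (rule finD)
  next
    show "label_independent C D m" unfolding label_independent_def
    proof (intro allI impI ballI)
      fix W v d
      assume v: "\<forall>d\<in>D. v d \<noteq> 0 \<longrightarrow> fst d \<subseteq> W" and z: "\<forall>c\<in>C. (\<Sum>d\<in>D. m c d * v d) = 0"
        and d: "d \<in> D" "fst d = W"
      have "(\<Sum>d\<in>D. fun_scale (v d) (\<lambda>c. m c d)) c = 0" for c
      proof (cases "c \<in> C")
        case True then show ?thesis using z by (simp add: sum_fun_scale mult.commute)
      next
        case False
        have "\<forall>d\<in>D. m c d = 0" using mK False unfolding K_def by blast
        then show ?thesis by (simp add: sum_fun_scale)
      qed
      then have z': "(\<Sum>d\<in>D. fun_scale (v d) (\<lambda>c. m c d)) = 0" by auto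
      have split: "(\<Sum>d\<in>D. fun_scale (v d) (\<lambda>c. m c d))
          = (\<Sum>d\<in>{d\<in>D. fst d = W}. fun_scale (v d) (\<lambda>c. m c d))
          + (\<Sum>d\<in>{d\<in>D. fst d \<noteq> W}. fun_scale (v d) (\<lambda>c. m c d))"
        by (subst sum.union_disjoint[symmetric]) (auto simp: finDW intro!: sum.cong)
      have low: "(\<Sum>d\<in>{d\<in>D. fst d \<noteq> W}. fun_scale (v d) (\<lambda>c. m c d)) \<in> N W"
      proof (rule fun_vs.subspace_sum[OF N_sub])
        fix d assume "d \<in> {d\<in>D. fst d \<noteq> W}"
        then have d: "d \<in> D" "fst d \<noteq> W" by auto
        show "fun_scale (v d) (\<lambda>c. m c d) \<in> N W"
        proof (cases "v d = 0")
          case True then show ?thesis using fun_vs.subspace_0[OF N_sub] by simp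
        next
          case False
          then have "fst d \<subset> W" using v d by blast
          then have "(\<lambda>c. m c d) \<in> N W"
            unfolding N_def using mK[OF d(1)] by (intro fun_vs.span_base) blast
          then show ?thesis using fun_vs.subspace_scale[OF N_sub] by blast
        qed
      qed
      \<comment> \<open>In a relation, the columns of label \<open>W\<close> balance those of
        smaller labels. Their sum thus lies in \<open>N W\<close>, and the complement property kills
        their coefficients.\<close>
      have eq: "(\<Sum>d\<in>{d\<in>D. fst d = W}. fun_scale (v d) (\<lambda>c. m c d))
          = - (\<Sum>d\<in>{d\<in>D. fst d \<noteq> W}. fun_scale (v d) (\<lambda>c. m c d))"
        unfolding eq_neg_iff_add_eq_0 by (rule trans[OF split[symmetric] z'])
      have "(\<Sum>d\<in>{d\<in>D. fst d = W}. fun_scale (v d) (\<lambda>c. m c d)) \<in> N W"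
        unfolding eq by (rule fun_vs.subspace_neg[OF N_sub low])
      then have *: "\<forall>x\<in>X W. v (W, the_inv_into {0..<card (X W)} (e W) x) = 0"
        unfolding sumX by (rule X(3))
      have "snd d \<in> {0..<card (X W)}" using d unfolding D_def by auto
      then have "e W (snd d) \<in> X W" "the_inv_into {0..<card (X W)} (e W) (e W (snd d)) = snd d"
        using e[of W] by (auto simp: bij_betw_def the_inv_into_f_f)
      then show "v d = 0" using * d by (metis prod.collapse)
    qed
  next
    fix c d assume "c \<in> C" "d \<in> D" "m c d \<noteq> 0"
    then show "fst c \<subset> fst d" using strict[OF mK, of d c] by blast
  next
    fix b d assume "b \<in> A" "d \<in> D"
    then show "(\<Sum>c\<in>C. l b c * m c d) = 0" using mK[of d] unfolding K_def by blast
  next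
    fix W v assume v: "\<forall>c\<in>C. v c \<noteq> 0 \<longrightarrow> fst c \<subseteq> W"
      and z: "\<forall>b\<in>A. (\<Sum>c\<in>C. l b c * v c) = 0"
    have "(\<lambda>c. if c \<in> C then v c else 0) \<in> K W"
      unfolding K_def
    proof (intro CollectI conjI allI impI ballI)
      fix c assume "(if c \<in> C then v c else 0) \<noteq> 0"
      then show "c \<in> C" and "fst c \<subseteq> W" using v by (metis, metis)
    qed (use z in auto)
    then have "(\<lambda>c. if c \<in> C then v c else 0) \<in> T W" using KT by blast
    then obtain u where u: "\<forall>d. u d \<noteq> 0 \<longrightarrow> fst d \<subseteq> W"
      "(\<lambda>c. if c \<in> C then v c else 0) = (\<Sum>d\<in>D. fun_scale (u d) (\<lambda>c. m c d))"
      unfolding T_def by blast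
    have "v c = (\<Sum>d\<in>D. m c d * u d)" if "c \<in> C" for c
      using fun_cong[OF u(2), of c] that by (simp add: sum_fun_scale mult.commute)
    then show "\<exists>u. (\<forall>d\<in>D. u d \<noteq> 0 \<longrightarrow> fst d \<subseteq> W) \<and> (\<forall>c\<in>C. v c = (\<Sum>d\<in>D. m c d * u d))"
      using u by blast
  qed
qed

section \<open>Uniqueness of minimal graded free resolutions\<close>

lemma lookup_single_mult:
  fixes t n :: "'v \<Rightarrow>\<^sub>0 nat" and p :: "('v, 'k::comm_ring_1) mpoly"
  shows "Poly_Mapping.lookup (Poly_Mapping.single t a * p) (t + n) = a * Poly_Mapping.lookup p n"
  by (simp add: lookup_mult lookup_single when_mult)

lemma in_keys_multE:
  assumes "Poly_Mapping.lookup (p * q) m \<noteq> 0"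
  obtains a b where "m = a + b" "a \<in> Poly_Mapping.keys p" "b \<in> Poly_Mapping.keys q"
  using assms keys_mult[of p q] by (auto simp: in_keys_iff)

lemma in_keys_sumE:
  assumes "Poly_Mapping.lookup (\<Sum>i\<in>I. f i) m \<noteq> 0"
  obtains i where "i \<in> I" "Poly_Mapping.lookup (f i) m \<noteq> 0"
  using assms unfolding lookup_sum by (meson sum.not_neutral_contains_not_neutral)

text \<open>Exponent vectors of naturals add up to zero only if both vanish. Reduction modulo the
  variables is expressed through this constant term from here on.\<close>

lemma lookup_mult_zero:
  fixes p q :: "('v, 'k::comm_ring_1) mpoly"
  shows "Poly_Mapping.lookup (p * q) 0 = Poly_Mapping.lookup p 0 * Poly_Mapping.lookup q 0"
proof -
  have add0: "a = 0 \<and> b = 0" if "a + b = (0 :: 'v \<Rightarrow>\<^sub>0 nat)" for a b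
    using that by (auto simp: poly_mapping_eq_iff fun_eq_iff lookup_add)
  define s where "s = Poly_Mapping.single (0 :: 'v \<Rightarrow>\<^sub>0 nat) (Poly_Mapping.lookup p 0)"
  have "Poly_Mapping.lookup ((p - s) * q) 0 = 0"
  proof (rule ccontr)
    assume "Poly_Mapping.lookup ((p - s) * q) 0 \<noteq> 0"
    then obtain a b where "0 = a + b" "a \<in> Poly_Mapping.keys (p - s)"
      by (rule in_keys_multE)
    then show False using add0[of a b] by (simp add: in_keys_iff lookup_minus s_def)
  qed
  moreover have "p * q = s * q + (p - s) * q" by (simp add: algebra_simps)
  moreover have "Poly_Mapping.lookup (s * q) 0 = Poly_Mapping.lookup p 0 * Poly_Mapping.lookup q 0"
    using lookup_single_mult[of 0 "Poly_Mapping.lookup p 0" q 0] by (simp add: s_def)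
  ultimately show ?thesis by (simp add: lookup_add)
qed

lemma mon_degree_zero [simp]: "mon_degree 0 = 0"
  by (simp add: mon_degree_def)

lemma mon_degree_add: "mon_degree (a + b) = mon_degree a + mon_degree b"
  unfolding mon_degree_def by (rule setsum_keys_plus_distrib) auto

section \<open>Graded matrices and lifting through images\<close>

definition graded_mat ::
  "nat list \<Rightarrow> nat list \<Rightarrow> ('v, 'k::comm_ring_1) mpoly mat \<Rightarrow> bool" where
  "graded_mat ds es A \<longleftrightarrow> A \<in> carrier_mat (length es) (length ds) \<and>
     (\<forall>r<length es. \<forall>c<length ds. \<forall>m\<in>Poly_Mapping.keys (A $$ (r, c)). mon_degree m + es ! r = ds ! c)"

lemma mult_mat_vec_index:
  assumes "A \<in> carrier_mat n m" "v \<in> carrier_vec m" "r < n"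
  shows "(A *\<^sub>v v) $ r = (\<Sum>c<m. A $$ (r, c) * v $ c)"
  using assms by (auto simp: scalar_prod_def lessThan_atLeast0 intro!: sum.cong)

lemma mult_mat_index:
  assumes "A \<in> carrier_mat n m" "B \<in> carrier_mat m k" "r < n" "c < k"
  shows "(A * B) $$ (r, c) = (\<Sum>b<m. A $$ (r, b) * B $$ (b, c))"
  using assms by (auto simp: scalar_prod_def lessThan_atLeast0 intro!: sum.cong)

lemma mult_unit_vec_index:
  fixes A :: "'a::comm_ring_1 mat"
  assumes "A \<in> carrier_mat n m" "c < m" "r < n"
  shows "(A *\<^sub>v unit_vec m c) $ r = A $$ (r, c)"
proof -
  have "(\<Sum>i<m. A $$ (r, i) * unit_vec m c $ i) = (\<Sum>i<m. if i = c then A $$ (r, i) else 0)"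
    by (rule sum.cong) (use assms in auto)
  then show ?thesis using assms by (simp add: mult_mat_vec_index[OF assms(1)])
qed

text \<open>Unit vectors detect the entries, which gives one direction; conversely, degrees add up
  in products of monomials.\<close>

lemma graded_hom_iff_graded_mat:
  fixes A :: "('v, 'k::comm_ring_1) mpoly mat"
  shows "graded_hom ds es A \<longleftrightarrow> graded_mat ds es A"
proof
  assume A: "graded_hom ds es A"
  have car: "A \<in> carrier_mat (length es) (length ds)" using A by (simp add: graded_hom_def)
  show "graded_mat ds es A" unfolding graded_mat_def
  proof (intro conjI car allI impI ballI)
    fix r c m assume r: "r < length es" and c: "c < length ds"
      and m: "m \<in> Poly_Mapping.keys (A $$ (r, c))"
    let ?u = "unit_vec (length ds) c :: ('v, 'k) mpoly vec"
    have "?u \<in> graded_component ds (ds ! c)" using c by (auto simp: graded_component_def)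
    then have "A *\<^sub>v ?u \<in> graded_component es (ds ! c)" using A by (simp add: graded_hom_def)
    then show "mon_degree m + es ! r = ds ! c"
      using r m mult_unit_vec_index[OF car c r] unfolding graded_component_def by simp
  qed
next
  assume A: "graded_mat ds es A"
  have car: "A \<in> carrier_mat (length es) (length ds)" using A by (simp add: graded_mat_def)
  show "graded_hom ds es A" unfolding graded_hom_def
  proof (intro conjI car allI ballI)
    fix e and v :: "('v, 'k) mpoly vec" assume v: "v \<in> graded_component ds e"
    then have vc: "v \<in> carrier_vec (length ds)" by (simp add: graded_component_def)
    have "mon_degree m + es ! r = e"
      if r: "r < length es" and m: "m \<in> Poly_Mapping.keys ((A *\<^sub>v v) $ r)" for r m
    proof -
      have "Poly_Mapping.lookup (\<Sum>c<length ds. A $$ (r, c) * v $ c) m \<noteq> 0"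
        using m by (simp add: in_keys_iff mult_mat_vec_index[OF car vc r])
      then obtain c where "c \<in> {..<length ds}"
        and c2: "Poly_Mapping.lookup (A $$ (r, c) * v $ c) m \<noteq> 0" by (rule in_keys_sumE)
      then have c: "c < length ds" by simp
      from c2 obtain a b where ab: "m = a + b" "a \<in> Poly_Mapping.keys (A $$ (r, c))"
        "b \<in> Poly_Mapping.keys (v $ c)" by (rule in_keys_multE)
      have "mon_degree a + es ! r = ds ! c" using A r c ab(2) by (simp add: graded_mat_def)
      moreover have "mon_degree b + ds ! c = e"
        using v c ab(3) by (simp add: graded_component_def)
      ultimately show ?thesis by (simp add: ab(1) mon_degree_add)
    qed
    then show "A *\<^sub>v v \<in> graded_component es e"
      using car vc unfolding graded_component_def by auto
  qed
qed

lemma graded_mat_mult: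
  fixes A B :: "('v, 'k::comm_ring_1) mpoly mat"
  assumes "graded_mat ds es A" "graded_mat cs ds B"
  shows "graded_mat cs es (A * B)"
proof -
  have car: "A \<in> carrier_mat (length es) (length ds)" "B \<in> carrier_mat (length ds) (length cs)"
    using assms by (simp_all add: graded_mat_def)
  have "(A * B) *\<^sub>v v \<in> graded_component es e" if v: "v \<in> graded_component cs e" for e v
  proof -
    have "v \<in> carrier_vec (length cs)" using v by (simp add: graded_component_def)
    moreover have "A *\<^sub>v (B *\<^sub>v v) \<in> graded_component es e"
      using assms v by (simp flip: graded_hom_iff_graded_mat add: graded_hom_def)
    ultimately show ?thesis using car by simp
  qed
  then show ?thesis using car
    by (simp flip: graded_hom_iff_graded_mat add: graded_hom_def)
qed

definition monomial_part :: "(('v \<Rightarrow>\<^sub>0 nat) \<Rightarrow> bool) \<Rightarrow> ('v, 'k::comm_ring_1) mpoly \<Rightarrow> ('v, 'k) mpoly"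
  where "monomial_part P p = Poly_Mapping.mapp (\<lambda>m a. a when P m) p"

lemma lookup_monomial_part:
  "Poly_Mapping.lookup (monomial_part P p) m = (if P m then Poly_Mapping.lookup p m else 0)"
  by (auto simp: monomial_part_def lookup_mapp in_keys_iff when_def)

lemma graded_preimage:
  fixes A :: "('v, 'k::comm_ring_1) mpoly mat"
  assumes A: "graded_mat ds es A" and u: "u \<in> carrier_vec (length ds)"
    and v: "A *\<^sub>v u \<in> graded_component es e"
  obtains w where "w \<in> graded_component ds e" "A *\<^sub>v w = A *\<^sub>v u"
proof
  have car: "A \<in> carrier_mat (length es) (length ds)" using A by (simp add: graded_mat_def)
  define w where "w = vec (length ds) (\<lambda>c. monomial_part (\<lambda>m. mon_degree m + ds ! c = e) (u $ c))"
  show w: "w \<in> graded_component ds e"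
    by (auto simp: graded_component_def w_def in_keys_iff lookup_monomial_part split: if_splits)
  have wc: "w \<in> carrier_vec (length ds)" by (simp add: w_def)
  have Aw: "A *\<^sub>v w \<in> graded_component es e"
    using A w by (simp flip: graded_hom_iff_graded_mat add: graded_hom_def)
  show "A *\<^sub>v w = A *\<^sub>v u"
  proof (rule eq_vecI)
    fix r assume "r < dim_vec (A *\<^sub>v u)"
    then have r: "r < length es" using car by simp
    show "(A *\<^sub>v w) $ r = (A *\<^sub>v u) $ r"
    proof (rule poly_mapping_eqI)
      fix m
      show "Poly_Mapping.lookup ((A *\<^sub>v w) $ r) m = Poly_Mapping.lookup ((A *\<^sub>v u) $ r) m"
      \<comment> \<open>Away from degree \<open>e\<close> both sides vanish; in degree
        \<open>e\<close> the dropped monomials cannot contribute.\<close>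
      proof (cases "mon_degree m + es ! r = e")
        case False
        have "m \<notin> Poly_Mapping.keys (x $ r)" if "x \<in> graded_component es e"
          for x :: "('v, 'k) mpoly vec"
          using that r False unfolding graded_component_def by auto
        from this[OF v] this[OF Aw] show ?thesis by (simp add: in_keys_iff)
      next
        case True
        have "Poly_Mapping.lookup (A $$ (r, c) * (u $ c - w $ c)) m = 0" if c: "c < length ds" for c
        proof (rule ccontr)
          assume "Poly_Mapping.lookup (A $$ (r, c) * (u $ c - w $ c)) m \<noteq> 0"
          then obtain a b where ab: "m = a + b" "a \<in> Poly_Mapping.keys (A $$ (r, c))"
            "b \<in> Poly_Mapping.keys (u $ c - w $ c)" by (rule in_keys_multE)
          have "mon_degree a + es ! r = ds ! c" using A r c ab(2) by (simp add: graded_mat_def)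
          moreover have "mon_degree b + ds ! c \<noteq> e"
            using ab(3) c by (auto simp: in_keys_iff lookup_minus w_def lookup_monomial_part)
          ultimately show False using True by (simp add: ab(1) mon_degree_add)
        qed
        then show ?thesis
          by (simp add: mult_mat_vec_index[OF car u r] mult_mat_vec_index[OF car wc r] lookup_sum
              right_diff_distrib lookup_minus)
      qed
    qed
  qed (use car in simp)
qed

lemma mat_factor_cols:
  fixes A B :: "'a::comm_ring_1 mat"
  assumes B: "B \<in> carrier_mat n p" and A: "A \<in> carrier_mat n k"
    and cols: "\<And>c. c < k \<Longrightarrow> u c \<in> carrier_vec p \<and> B *\<^sub>v u c = col A c"
  shows "B * mat p k (\<lambda>(i, j). u j $ i) = A"
proof (rule mat_col_eqI)
  fix j assume "j < dim_col A"
  then have j: "j < k" using A by simp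
  have "col (B * mat p k (\<lambda>(i, j). u j $ i)) j = B *\<^sub>v col (mat p k (\<lambda>(i, j). u j $ i)) j"
    by (rule col_mult2[OF B _ j]) simp
  also have "col (mat p k (\<lambda>(i, j). u j $ i)) j = u j"
    using cols[OF j] j by (intro eq_vecI) auto
  finally show "col (B * mat p k (\<lambda>(i, j). u j $ i)) j = col A j" using cols[OF j] by simp
qed (use A B in auto)

text \<open>Free modules are projective: preimages of the columns of \<open>A\<close> are the
  columns of \<open>h\<close>.\<close>

lemma factor_through_image:
  fixes A B :: "'a::comm_ring_1 mat"
  assumes B: "B \<in> carrier_mat n p" and A: "A \<in> carrier_mat n k"
    and cols: "\<And>c. c < k \<Longrightarrow> col A c \<in> mat_image B"
  obtains h where "h \<in> carrier_mat p k" "B * h = A"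
proof -
  have "\<exists>u. u \<in> carrier_vec p \<and> B *\<^sub>v u = col A c" if "c < k" for c
    using cols[OF that] B unfolding mat_image_def by auto
  then obtain u where "\<And>c. c < k \<Longrightarrow> u c \<in> carrier_vec p \<and> B *\<^sub>v u c = col A c" by metis
  from that[OF _ mat_factor_cols[OF B A this]] show thesis by simp
qed

text \<open>Choosing each preimage homogeneous, in the degree of its column, makes \<open>h\<close>
  homogeneous of degree 0.\<close>

lemma graded_factor_through_image:
  fixes A B :: "('v, 'k::comm_ring_1) mpoly mat"
  assumes B: "graded_mat ds es B" and A: "graded_mat cs es A"
    and cols: "\<And>c. c < length cs \<Longrightarrow> col A c \<in> mat_image B"
  obtains h where "graded_mat cs ds h" "B * h = A"
proof -
  have Bc: "B \<in> carrier_mat (length es) (length ds)" and Ac: "A \<in> carrier_mat (length es) (length cs)"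
    using A B by (simp_all add: graded_mat_def)
  have "\<exists>u. u \<in> graded_component ds (cs ! c) \<and> B *\<^sub>v u = col A c" if c: "c < length cs" for c
  proof -
    obtain u where u: "u \<in> carrier_vec (length ds)" "B *\<^sub>v u = col A c"
      using cols[OF c] Bc unfolding mat_image_def by auto
    have "col A c \<in> graded_component es (cs ! c)"
      using A c Ac by (auto simp: graded_component_def graded_mat_def)
    then show ?thesis using graded_preimage[OF B u(1)] u(2) by metis
  qed
  then obtain u where u: "\<And>c. c < length cs \<Longrightarrow> u c \<in> graded_component ds (cs ! c) \<and> B *\<^sub>v u c = col A c"
    by metis
  then have uc: "\<And>c. c < length cs \<Longrightarrow> u c \<in> carrier_vec (length ds) \<and> B *\<^sub>v u c = col A c"
    by (simp add: graded_component_def)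
  have "graded_mat cs ds (mat (length ds) (length cs) (\<lambda>(i, j). u j $ i))"
    using u by (auto simp: graded_mat_def graded_component_def)
  from that[OF this mat_factor_cols[OF Bc Ac uc]] show thesis by simp
qed

text \<open>One factor is zero modulo the variables. This is how minimality enters the
  comparison.\<close>

lemma lookup_mult_mat_zero:
  fixes A B C :: "('v, 'k::comm_ring_1) mpoly mat"
  assumes "A \<in> carrier_mat n m" "B \<in> carrier_mat m k" "r < n" "c < k"
    and "(\<forall>r<n. \<forall>b<m. Poly_Mapping.lookup (A $$ (r, b)) 0 = 0) \<or>
      (\<forall>b<m. \<forall>c<k. Poly_Mapping.lookup (B $$ (b, c)) 0 = 0)"
  shows "Poly_Mapping.lookup ((A * B) $$ (r, c)) 0 = 0"
  using assms(3-5)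
  by (auto simp: mult_mat_index[OF assms(1-4)] lookup_sum lookup_mult_zero intro!: sum.neutral)

lemma col_in_mat_image:
  fixes A :: "'a::comm_ring_1 mat"
  assumes "c < dim_col A"
  shows "col A c \<in> mat_image A"
proof -
  have "col A c = A *\<^sub>v unit_vec (dim_col A) c"
    by (rule eq_vecI) (auto simp: assms mult_unit_vec_index[OF carrier_matI])
  then show ?thesis unfolding mat_image_def using assms by auto
qed

lemma col_in_mat_kernel:
  fixes A B :: "'a::comm_ring_1 mat"
  assumes A: "A \<in> carrier_mat n m" and B: "B \<in> carrier_mat m k" and z: "A * B = 0\<^sub>m n k"
    and c: "c < k"
  shows "col B c \<in> mat_kernel A"
proof (rule mat_kernelI[OF A])
  show "col B c \<in> carrier_vec m" using B by auto
  have "A *\<^sub>v col B c = col (A * B) c" by (rule col_mult2[OF A B c, symmetric])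
  then show "A *\<^sub>v col B c = 0\<^sub>v n" using z c by simp
qed

section \<open>Comparison of two minimal resolutions\<close>

locale two_minimal_resolutions =
  fixes I :: "('v, 'k::field) mpoly set" and ds es :: "nat \<Rightarrow> nat list"
    and \<phi> \<psi> :: "nat \<Rightarrow> ('v, 'k) mpoly mat"
  assumes res_\<phi>: "minimal_graded_free_resolution I ds \<phi>"
    and res_\<psi>: "minimal_graded_free_resolution I es \<psi>"
begin

lemma graded:
  "graded_mat (ds 0) [0] (\<phi> 0)" "graded_mat (ds (Suc i)) (ds i) (\<phi> (Suc i))"
  "graded_mat (es 0) [0] (\<psi> 0)" "graded_mat (es (Suc i)) (es i) (\<psi> (Suc i))"
  using res_\<phi> res_\<psi>
  by (simp_all add: minimal_graded_free_resolution_def graded_hom_iff_graded_mat)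

lemma carrier:
  "\<phi> 0 \<in> carrier_mat 1 (length (ds 0))" "\<phi> (Suc i) \<in> carrier_mat (length (ds i)) (length (ds (Suc i)))"
  "\<psi> 0 \<in> carrier_mat 1 (length (es 0))" "\<psi> (Suc i) \<in> carrier_mat (length (es i)) (length (es (Suc i)))"
  using graded by (simp_all add: graded_mat_def)

lemma dims:
  "dim_col (\<phi> i) = length (ds i)" "dim_col (\<psi> i) = length (es i)"
  "dim_row (\<phi> (Suc i)) = length (ds i)" "dim_row (\<psi> (Suc i)) = length (es i)"
  using carrier by (cases i; auto)+

lemma carrier':
  "\<phi> i \<in> carrier_mat (dim_row (\<phi> i)) (length (ds i))"
  "\<psi> i \<in> carrier_mat (dim_row (\<psi> i)) (length (es i))"
  by (auto simp: dims)

lemma image_eq_kernel: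
  "mat_image (\<phi> (Suc i)) = mat_kernel (\<phi> i)" "mat_image (\<psi> (Suc i)) = mat_kernel (\<psi> i)"
  using res_\<phi> res_\<psi> by (simp_all add: minimal_graded_free_resolution_def)

lemma complex:
  "\<phi> i * \<phi> (Suc i) = 0\<^sub>m (dim_row (\<phi> i)) (length (ds (Suc i)))"
proof (rule mat_col_eqI)
  fix c assume "c < dim_col (0\<^sub>m (dim_row (\<phi> i)) (length (ds (Suc i))) :: ('v, 'k) mpoly mat)"
  then have c: "c < length (ds (Suc i))" by simp
  then have "col (\<phi> (Suc i)) c \<in> mat_kernel (\<phi> i)"
    using col_in_mat_image[of c "\<phi> (Suc i)"] by (simp add: dims image_eq_kernel)
  then have "\<phi> i *\<^sub>v col (\<phi> (Suc i)) c = 0\<^sub>v (dim_row (\<phi> i))"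
    by (simp add: mat_kernel_def)
  then show "col (\<phi> i * \<phi> (Suc i)) c = col (0\<^sub>m (dim_row (\<phi> i)) (length (ds (Suc i)))) c"
    using col_mult2[OF carrier'(1) carrier(2) c] c by simp
qed (auto simp: dims)

lemma lift_\<phi>:
  assumes "X \<in> carrier_mat (length (ds i)) k" "\<phi> i * X = 0\<^sub>m (dim_row (\<phi> i)) k"
  obtains h where "h \<in> carrier_mat (length (ds (Suc i))) k" "\<phi> (Suc i) * h = X"
  by (rule factor_through_image[OF carrier(2)[of i] assms(1)])
    (use col_in_mat_kernel[OF carrier'(1) assms] image_eq_kernel in auto)

text \<open>\<open>P\<close> and \<open>Q\<close> are the components in degree \<open>i\<close> of
  comparison maps in both directions, and \<open>h\<close> is the outgoing homotopy component. The
  usual equation \<open>Q P - 1 = \<phi> (i+1) h + h' \<phi> i\<close> is recorded only after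
  composition with \<open>\<phi> (Suc i)\<close>, which removes the previous component
  \<open>h'\<close>. The two vanishing conditions allow lifting to the next degree.\<close>

definition homotopic_to_id ::
  "nat \<Rightarrow> ('v, 'k) mpoly mat \<Rightarrow> ('v, 'k) mpoly mat \<Rightarrow> ('v, 'k) mpoly mat \<Rightarrow> bool" where
  "homotopic_to_id i P Q h \<longleftrightarrow>
     graded_mat (ds i) (es i) P \<and> graded_mat (es i) (ds i) Q \<and>
     h \<in> carrier_mat (length (ds (Suc i))) (length (ds i)) \<and>
     \<psi> i * (P * \<phi> (Suc i)) = 0\<^sub>m (dim_row (\<psi> i)) (length (ds (Suc i))) \<and>
     \<phi> i * (Q * \<psi> (Suc i)) = 0\<^sub>m (dim_row (\<phi> i)) (length (es (Suc i))) \<and>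
     Q * (P * \<phi> (Suc i)) = \<phi> (Suc i) + \<phi> (Suc i) * (h * \<phi> (Suc i)) \<and>
     (\<forall>r<length (ds i). \<forall>c<length (ds i).
        Poly_Mapping.lookup ((Q * P) $$ (r, c)) 0 = (if r = c then 1 else 0))"

lemma complex':
  "\<psi> i * \<psi> (Suc i) = 0\<^sub>m (dim_row (\<psi> i)) (length (es (Suc i)))"
proof -
  interpret swap: two_minimal_resolutions I es ds \<psi> \<phi> by unfold_locales (rule res_\<psi> res_\<phi>)+
  show ?thesis by (rule swap.complex)
qed

text \<open>\<open>H\<close> plays the role of the incoming homotopy term. The matrix
  \<open>Q * P - (1 + H)\<close> is killed by \<open>\<phi> i\<close>, so it equals
  \<open>\<phi> (Suc i) * h\<close>. Neither this product nor \<open>H\<close> has constant terms,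
  so \<open>Q * P\<close> is the identity modulo the variables.\<close>

lemma homotopic_to_idI:
  assumes P: "graded_mat (ds i) (es i) P" and Q: "graded_mat (es i) (ds i) Q"
    and H: "H \<in> carrier_mat (length (ds i)) (length (ds i))"
    and H0: "\<And>r c. r < length (ds i) \<Longrightarrow> c < length (ds i) \<Longrightarrow> Poly_Mapping.lookup (H $$ (r, c)) 0 = 0"
    and QP: "\<phi> i * (Q * P) = \<phi> i + \<phi> i * H"
    and H\<phi>: "H * \<phi> (Suc i) = 0\<^sub>m (length (ds i)) (length (ds (Suc i)))"
    and "\<psi> i * (P * \<phi> (Suc i)) = 0\<^sub>m (dim_row (\<psi> i)) (length (ds (Suc i)))"
    and "\<phi> i * (Q * \<psi> (Suc i)) = 0\<^sub>m (dim_row (\<phi> i)) (length (es (Suc i)))"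
  shows "\<exists>h. homotopic_to_id i P Q h"
proof -
  let ?n = "length (ds i)" and ?n' = "length (ds (Suc i))" and ?A = "\<phi> i" and ?B = "\<phi> (Suc i)"
  have Pc: "P \<in> carrier_mat (length (es i)) ?n" and Qc: "Q \<in> carrier_mat ?n (length (es i))"
    using P Q by (simp_all add: graded_mat_def)
  have QPc: "Q * P \<in> carrier_mat ?n ?n" using Pc Qc by simp
  have A: "?A \<in> carrier_mat (dim_row ?A) ?n" by (rule carrier'(1))
  have B: "?B \<in> carrier_mat ?n ?n'" by (rule carrier(2))
  have N: "Q * P - (1\<^sub>m ?n + H) \<in> carrier_mat ?n ?n" using H by (intro minus_carrier_mat) auto
  have "?A * (Q * P - (1\<^sub>m ?n + H)) = ?A * (Q * P) - ?A * (1\<^sub>m ?n + H)"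
    by (rule mult_minus_distrib_mat[OF A QPc]) (use H in auto)
  also have "?A * (1\<^sub>m ?n + H) = ?A * 1\<^sub>m ?n + ?A * H"
    by (rule mult_add_distrib_mat[OF A _ H]) simp
  also have "?A * 1\<^sub>m ?n = ?A" by (rule right_mult_one_mat[OF A])
  also have "?A * (Q * P) - (?A + ?A * H) = 0\<^sub>m (dim_row ?A) ?n"
    unfolding QP by (intro minus_r_inv_mat add_carrier_mat mult_carrier_mat[OF A H])
  finally obtain h where h: "h \<in> carrier_mat ?n' ?n" "?B * h = Q * P - (1\<^sub>m ?n + H)"
    by (rule lift_\<phi>[OF N])
  have Bh: "?B * h \<in> carrier_mat ?n ?n" using B h(1) by simp
  have sum: "Q * P = ?B * h + (1\<^sub>m ?n + H)"
    unfolding h(2) using QPc H Pc Qc by (intro eq_matI) auto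
  have "Q * (P * ?B) = (Q * P) * ?B" using Pc Qc B by simp
  also have "\<dots> = ?B * h * ?B + (1\<^sub>m ?n + H) * ?B"
    unfolding sum by (rule add_mult_distrib_mat[OF Bh _ B]) (use H in auto)
  also have "(1\<^sub>m ?n + H) * ?B = 1\<^sub>m ?n * ?B + H * ?B"
    by (rule add_mult_distrib_mat[OF _ H B]) auto
  also have "\<dots> = ?B" unfolding H\<phi> using B by simp
  also have "?B * h * ?B = ?B * (h * ?B)" by (rule assoc_mult_mat[OF B h(1) B])
  also have "?B * (h * ?B) + ?B = ?B + ?B * (h * ?B)"
    by (rule comm_add_mat[of _ ?n ?n']) (use B h(1) in auto)
  finally have hom: "Q * (P * ?B) = ?B + ?B * (h * ?B)" .
  have minimal: "Poly_Mapping.lookup (?B $$ (r, c)) 0 = 0" if "r < ?n" "c < ?n'" for r c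
    using res_\<phi> that by (simp add: minimal_graded_free_resolution_def)
  have "Poly_Mapping.lookup ((Q * P) $$ (r, c)) 0 = (if r = c then 1 else 0)"
    if rc: "r < ?n" "c < ?n" for r c
  proof -
    have "Poly_Mapping.lookup ((?B * h) $$ (r, c)) 0 = 0"
      by (rule lookup_mult_mat_zero[OF B h(1) rc]) (simp add: minimal)
    moreover have "(Q * P) $$ (r, c) = (?B * h) $$ (r, c) + ((if r = c then 1 else 0) + H $$ (r, c))"
      unfolding sum using rc H Bh by (simp del: index_mult_mat)
    ultimately show ?thesis using H0[OF rc] by (simp add: lookup_add)
  qed
  then show ?thesis unfolding homotopic_to_id_def by (intro exI[of _ h] conjI allI impI assms(1,2,7,8) h(1) hom)
qed

text \<open>Both augmentations have image \<open>I\<close>, so each factors through the other. Then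
  \<open>Q * P\<close> is compatible with \<open>\<phi> 0\<close> on the nose, and the incoming term
  \<open>H\<close> is zero.\<close>

lemma homotopic_to_id_0: "\<exists>P Q h. homotopic_to_id 0 P Q h"
proof -
  have im: "mat_image (\<phi> 0) = mat_image (\<psi> 0)"
    using res_\<phi> res_\<psi> by (simp add: minimal_graded_free_resolution_def)
  obtain P where P: "graded_mat (ds 0) (es 0) P" "\<psi> 0 * P = \<phi> 0"
    by (rule graded_factor_through_image[OF graded(3) graded(1)])
      (use col_in_mat_image[of _ "\<phi> 0"] im in \<open>auto simp: dims\<close>)
  obtain Q where Q: "graded_mat (es 0) (ds 0) Q" "\<phi> 0 * Q = \<psi> 0"
    by (rule graded_factor_through_image[OF graded(1) graded(3)])
      (use col_in_mat_image[of _ "\<psi> 0"] im in \<open>auto simp: dims\<close>)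
  have Pc: "P \<in> carrier_mat (length (es 0)) (length (ds 0))"
    and Qc: "Q \<in> carrier_mat (length (ds 0)) (length (es 0))"
    using P Q by (simp_all add: graded_mat_def)
  have "\<phi> 0 * (Q * P) = \<phi> 0 * Q * P" by (rule assoc_mult_mat[OF carrier(1) Qc Pc, symmetric])
  then have QP: "\<phi> 0 * (Q * P) = \<phi> 0" by (simp add: P Q)
  have "\<psi> 0 * (P * \<phi> 1) = \<psi> 0 * P * \<phi> 1"
    using assoc_mult_mat[OF carrier(3) Pc carrier(2)] by simp
  then have z1: "\<psi> 0 * (P * \<phi> 1) = 0\<^sub>m 1 (length (ds 1))" using complex[of 0] carrier(1) by (simp add: P)
  have "\<phi> 0 * (Q * \<psi> 1) = \<phi> 0 * Q * \<psi> 1"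
    using assoc_mult_mat[OF carrier(1) Qc carrier(4)] by simp
  then have z2: "\<phi> 0 * (Q * \<psi> 1) = 0\<^sub>m 1 (length (es 1))" using complex'[of 0] carrier(3) by (simp add: Q)
  have "\<exists>h. homotopic_to_id 0 P Q h"
    by (rule homotopic_to_idI[OF P(1) Q(1), where H = "0\<^sub>m (length (ds 0)) (length (ds 0))"])
      (use QP z1 z2 carrier(1,3) carrier(2)[of 0] in \<open>auto simp: \<close>)
  then show ?thesis by blast
qed

text \<open>The comparison maps lift by exactness. The incoming term is now
  \<open>h * \<phi> (Suc i)\<close>: it is killed by composition with the next differential, and it
  has no constant terms by minimality.\<close>

lemma homotopic_to_id_Suc:
  assumes "homotopic_to_id i P Q h"
  shows "\<exists>P Q h. homotopic_to_id (Suc i) P Q h"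
proof -
  let ?A = "\<phi> (Suc i)" and ?B = "\<psi> (Suc i)"
  note hi = assms[unfolded homotopic_to_id_def]
  have P: "graded_mat (ds i) (es i) P" and Q: "graded_mat (es i) (ds i) Q"
    and h: "h \<in> carrier_mat (length (ds (Suc i))) (length (ds i))"
    and z: "\<psi> i * (P * ?A) = 0\<^sub>m (dim_row (\<psi> i)) (length (ds (Suc i)))"
      "\<phi> i * (Q * ?B) = 0\<^sub>m (dim_row (\<phi> i)) (length (es (Suc i)))"
    and hom: "Q * (P * ?A) = ?A + ?A * (h * ?A)"
    by (insert hi, (elim conjE, assumption)+)
  note A = carrier(2)[of i] and B = carrier(4)[of i]
  note A' = carrier(2)[of "Suc i"] and B' = carrier(4)[of "Suc i"]
  have PA: "graded_mat (ds (Suc i)) (es i) (P * ?A)" and QB: "graded_mat (es (Suc i)) (ds i) (Q * ?B)"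
    by (rule graded_mat_mult[OF P graded(2)], rule graded_mat_mult[OF Q graded(4)])
  have PAc: "P * ?A \<in> carrier_mat (length (es i)) (length (ds (Suc i)))"
    and QBc: "Q * ?B \<in> carrier_mat (length (ds i)) (length (es (Suc i)))"
    using PA QB by (simp_all add: graded_mat_def)
  have Pc: "P \<in> carrier_mat (length (es i)) (length (ds i))"
    and Qc: "Q \<in> carrier_mat (length (ds i)) (length (es i))"
    using P Q by (simp_all add: graded_mat_def)
  obtain P' where P': "graded_mat (ds (Suc i)) (es (Suc i)) P'" "?B * P' = P * ?A"
    by (rule graded_factor_through_image[OF graded(4) PA])
      (use col_in_mat_kernel[OF carrier'(2) PAc z(1)] image_eq_kernel in auto)
  obtain Q' where Q': "graded_mat (es (Suc i)) (ds (Suc i)) Q'" "?A * Q' = Q * ?B"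
    by (rule graded_factor_through_image[OF graded(2) QB])
      (use col_in_mat_kernel[OF carrier'(1) QBc z(2)] image_eq_kernel in auto)
  have P'c: "P' \<in> carrier_mat (length (es (Suc i))) (length (ds (Suc i)))"
    and Q'c: "Q' \<in> carrier_mat (length (ds (Suc i))) (length (es (Suc i)))"
    using P' Q' by (simp_all add: graded_mat_def)
  have "?A * (Q' * P') = ?A * Q' * P'" by (rule assoc_mult_mat[OF A Q'c P'c, symmetric])
  also have "\<dots> = Q * (?B * P')" unfolding Q'(2) by (rule assoc_mult_mat[OF Qc B P'c])
  also have "\<dots> = ?A + ?A * (h * ?A)" unfolding P'(2) by (rule hom)
  finally have eq: "?A * (Q' * P') = ?A + ?A * (h * ?A)" .
  have cA: "?A * \<phi> (Suc (Suc i)) = 0\<^sub>m (length (ds i)) (length (ds (Suc (Suc i))))"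
    and cB: "?B * \<psi> (Suc (Suc i)) = 0\<^sub>m (length (es i)) (length (es (Suc (Suc i))))"
    using complex[of "Suc i"] complex'[of "Suc i"] by (simp_all add: dims)
  have "h * ?A * \<phi> (Suc (Suc i)) = h * (?A * \<phi> (Suc (Suc i)))" by (rule assoc_mult_mat[OF h A A'])
  then have hA: "h * ?A * \<phi> (Suc (Suc i)) = 0\<^sub>m (length (ds (Suc i))) (length (ds (Suc (Suc i))))"
    using h by (simp add: cA)
  have "?B * (P' * \<phi> (Suc (Suc i))) = P * ?A * \<phi> (Suc (Suc i))"
    using assoc_mult_mat[OF B P'c A'] P'(2) by simp
  also have "\<dots> = P * (?A * \<phi> (Suc (Suc i)))" by (rule assoc_mult_mat[OF Pc A A'])
  finally have z1: "?B * (P' * \<phi> (Suc (Suc i))) = 0\<^sub>m (dim_row ?B) (length (ds (Suc (Suc i))))"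
    using Pc by (simp add: cA dims)
  have "?A * (Q' * \<psi> (Suc (Suc i))) = Q * ?B * \<psi> (Suc (Suc i))"
    using assoc_mult_mat[OF A Q'c B'] Q'(2) by simp
  also have "\<dots> = Q * (?B * \<psi> (Suc (Suc i)))" by (rule assoc_mult_mat[OF Qc B B'])
  finally have z2: "?A * (Q' * \<psi> (Suc (Suc i))) = 0\<^sub>m (dim_row ?A) (length (es (Suc (Suc i))))"
    using Qc by (simp add: cB dims)
  have "Poly_Mapping.lookup ((h * ?A) $$ (r, c)) 0 = 0"
    if "r < length (ds (Suc i))" "c < length (ds (Suc i))" for r c
    by (rule lookup_mult_mat_zero[OF h A that])
      (use res_\<phi> in \<open>simp add: minimal_graded_free_resolution_def\<close>)
  then have "\<exists>h. homotopic_to_id (Suc i) P' Q' h"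
    using homotopic_to_idI[OF P'(1) Q'(1) mult_carrier_mat[OF h A] _ eq hA z1 z2] by blast
  then show ?thesis by blast
qed

lemma ex_homotopic_to_id: "\<exists>P Q h. homotopic_to_id i P Q h"
  by (induction i) (use homotopic_to_id_0 homotopic_to_id_Suc in blast)+

text \<open>The constant terms of \<open>P\<close> and \<open>Q\<close> are scalar matrices with
  \<open>Q P = 1\<close>. They respect shifts, so this holds on the block of shift \<open>j\<close>
  alone, and the block sizes compare.\<close>

lemma count_list_le: "count_list (ds i) j \<le> count_list (es i) j"
proof -
  obtain P Q h where "homotopic_to_id i P Q h" using ex_homotopic_to_id by blast
  note hi = this[unfolded homotopic_to_id_def]
  have P: "graded_mat (ds i) (es i) P" and Q: "graded_mat (es i) (ds i) Q"
    by (insert hi, (elim conjE, assumption)+)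
  have id: "\<And>r c. r < length (ds i) \<Longrightarrow> c < length (ds i) \<Longrightarrow>
      Poly_Mapping.lookup ((Q * P) $$ (r, c)) 0 = (if r = c then 1 else 0)"
    by (insert hi) (elim conjE, simp del: index_mult_mat)
  have Pc: "P \<in> carrier_mat (length (es i)) (length (ds i))"
    and Qc: "Q \<in> carrier_mat (length (ds i)) (length (es i))"
    using P Q by (simp_all add: graded_mat_def)
  let ?C = "{c. c < length (ds i) \<and> ds i ! c = j}" and ?R = "{r. r < length (es i) \<and> es i ! r = j}"
  have "card ?C \<le> card ?R"
  proof (rule card_le_if_left_inverse)
    fix c c' assume c: "c \<in> ?C" and c': "c' \<in> ?C"
    have "(\<Sum>r\<in>?R. Poly_Mapping.lookup (Q $$ (c, r)) 0 * Poly_Mapping.lookup (P $$ (r, c')) 0)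
      = (\<Sum>r<length (es i). Poly_Mapping.lookup (Q $$ (c, r)) 0 * Poly_Mapping.lookup (P $$ (r, c')) 0)"
    proof (rule sum.mono_neutral_left)
      show "\<forall>r\<in>{..<length (es i)} - ?R.
          Poly_Mapping.lookup (Q $$ (c, r)) 0 * Poly_Mapping.lookup (P $$ (r, c')) 0 = 0"
      proof
        fix r assume "r \<in> {..<length (es i)} - ?R"
        then have r: "r < length (es i)" "es i ! r \<noteq> j" by auto
        \<comment> \<open>The constant monomial has degree 0, so it can occur only between equal
          shifts.\<close>
        have "0 \<notin> Poly_Mapping.keys (P $$ (r, c'))"
          using P r c' unfolding graded_mat_def by fastforce
        then show "Poly_Mapping.lookup (Q $$ (c, r)) 0 * Poly_Mapping.lookup (P $$ (r, c')) 0 = 0"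
          by (simp add: in_keys_iff)
      qed
    qed auto
    also have "\<dots> = Poly_Mapping.lookup ((Q * P) $$ (c, c')) 0"
      using mult_mat_index[OF Qc Pc, of c c'] c c' by (simp add: lookup_sum lookup_mult_zero)
    finally show "(\<Sum>r\<in>?R. Poly_Mapping.lookup (Q $$ (c, r)) 0 * Poly_Mapping.lookup (P $$ (r, c')) 0)
        = (if c = c' then 1 else 0)"
      using id[of c c'] c c' by simp
  qed auto
  then show ?thesis
    by (simp add: count_list_eq_length_filter length_filter_conv_card eq_commute[of j])
qed

end

text \<open>The inequality in both directions makes the description in \<open>betti\<close>
  definite, so any one resolution computes it.\<close>

theorem betti_eq_count_list:
  assumes "minimal_graded_free_resolution I ds \<phi>"
  shows "betti I i j = count_list (ds i) j"
  unfolding betti_def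
proof (rule the_equality)
  fix n assume "\<exists>ds \<phi>. minimal_graded_free_resolution I ds \<phi> \<and> n = count_list (ds i) j"
  then obtain es \<psi> where es: "minimal_graded_free_resolution I es \<psi>" "n = count_list (es i) j"
    by blast
  interpret le: two_minimal_resolutions I ds es \<phi> \<psi> by unfold_locales (rule assms es)+
  interpret ge: two_minimal_resolutions I es ds \<psi> \<phi> by unfold_locales (rule assms es)+
  show "n = count_list (ds i) j"
    using le.count_list_le[of i j] ge.count_list_le[of i j] es(2) by simp
qed (use assms in blast)

section \<open>Multigraded resolutions of squarefree monomial ideals\<close>

text \<open>A pair \<open>(W, k)\<close> is a basis element of multidegree \<open>W\<close>, where \<open>k\<close> distinguishes
  elements of equal multidegree. The scalars \<open>l n b c\<close> stand for the matrix entries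
  \<open>l n b c \<cdot> x\<^bsup>c - b\<^esup>\<close> of the map from position \<open>n + 1\<close> to position \<open>n\<close>, and \<open>B 0\<close> is the
  basis of \<open>R\<close> itself.\<close>

locale multigraded_resolution =
  fixes S :: "'v::finite set set" and B :: "nat \<Rightarrow> ('v set \<times> nat) set"
    and l :: "nat \<Rightarrow> 'v set \<times> nat \<Rightarrow> 'v set \<times> nat \<Rightarrow> 'k::field"
  assumes B_0: "B 0 = {({}, 0)}" and B_1: "B (Suc 0) = S \<times> {0}"
    and augmentation: "F \<in> S \<Longrightarrow> l 0 ({}, 0) (F, 0) = 1"
    and finite_B: "finite (B n)"
    and strict: "b \<in> B n \<Longrightarrow> c \<in> B (Suc n) \<Longrightarrow> l n b c \<noteq> 0 \<Longrightarrow> fst b \<subset> fst c"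
    and nonzero: "c \<in> B (Suc n) \<Longrightarrow> \<exists>b\<in>B n. l n b c \<noteq> 0"
    and complex: "b \<in> B n \<Longrightarrow> d \<in> B (Suc (Suc n)) \<Longrightarrow> (\<Sum>c\<in>B (Suc n). l n b c * l (Suc n) c d) = 0"
    and exact: "(\<And>c. c \<in> B (Suc n) \<Longrightarrow> v c \<noteq> 0 \<Longrightarrow> fst c \<subseteq> W) \<Longrightarrow>
       (\<And>b. b \<in> B n \<Longrightarrow> (\<Sum>c\<in>B (Suc n). l n b c * v c) = 0) \<Longrightarrow>
       \<exists>u. (\<forall>d\<in>B (Suc (Suc n)). u d \<noteq> 0 \<longrightarrow> fst d \<subseteq> W) \<and>
         (\<forall>c\<in>B (Suc n). v c = (\<Sum>d\<in>B (Suc (Suc n)). l (Suc n) c d * u d))"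

text \<open>The syzygy step is iterated by dependent choice, starting from the generators. That
  these form an antichain gives the initial independence.\<close>

lemma ex_multigraded_resolution:
  fixes S :: "'v::finite set set"
  assumes ne: "{} \<notin> S" and antichain: "\<And>F G. F \<in> S \<Longrightarrow> G \<in> S \<Longrightarrow> F \<subseteq> G \<Longrightarrow> F = G"
  obtains B and l :: "nat \<Rightarrow> 'v set \<times> nat \<Rightarrow> 'v set \<times> nat \<Rightarrow> 'k::field"
  where "multigraded_resolution S B l"
proof -
  \<comment> \<open>A state consists of two consecutive bases and the scalar matrix between them;
    \<open>P\<close> is its invariant and \<open>Q\<close> links it to its successor.\<close>
  define P where "P n x \<longleftrightarrow> (case x of (A, C, m) \<Rightarrow>
      finite A \<and> finite C \<and> label_independent A C m \<and>
      (\<forall>b\<in>A. \<forall>c\<in>C. m b c \<noteq> 0 \<longrightarrow> fst b \<subset> fst c) \<and>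
      (n = 0 \<longrightarrow> A = {({}, 0)} \<and> C = S \<times> {0} \<and> (\<forall>F\<in>S. m ({}, 0) (F, 0) = 1)))"
    for n :: nat and x :: "('v set \<times> nat) set \<times> ('v set \<times> nat) set \<times> ('v set \<times> nat \<Rightarrow> 'v set \<times> nat \<Rightarrow> 'k)"
  define Q where "Q x y \<longleftrightarrow> (case x of (A, C, m) \<Rightarrow> case y of (A', D, m') \<Rightarrow> A' = C \<and>
      (\<forall>b\<in>A. \<forall>d\<in>D. (\<Sum>c\<in>C. m b c * m' c d) = 0) \<and>
      (\<forall>W v. (\<forall>c\<in>C. v c \<noteq> 0 \<longrightarrow> fst c \<subseteq> W) \<longrightarrow> (\<forall>b\<in>A. (\<Sum>c\<in>C. m b c * v c) = 0) \<longrightarrow>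
        (\<exists>u. (\<forall>d\<in>D. u d \<noteq> 0 \<longrightarrow> fst d \<subseteq> W) \<and> (\<forall>c\<in>C. v c = (\<Sum>d\<in>D. m' c d * u d)))))"
    for x y :: "('v set \<times> nat) set \<times> ('v set \<times> nat) set \<times> ('v set \<times> nat \<Rightarrow> 'v set \<times> nat \<Rightarrow> 'k)"
  have start: "label_independent {({}, 0)} (S \<times> {0}) (\<lambda>b c. 1 :: 'k)"
    unfolding label_independent_def
  proof (intro allI impI ballI)
    fix W :: "'v set" and v :: "'v set \<times> nat \<Rightarrow> 'k" and c :: "'v set \<times> nat"
    assume supp: "\<forall>c\<in>S \<times> {0}. v c \<noteq> 0 \<longrightarrow> fst c \<subseteq> W"
      and z: "\<forall>b\<in>{({}, 0)}. (\<Sum>c\<in>S \<times> {0}. 1 * v c) = 0"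
      and c: "c \<in> S \<times> {0}" "fst c = W"
    \<comment> \<open>The support lies in labels below \<open>fst c\<close>. In an antichain only
      \<open>c\<close> itself remains, so the single equation reads \<open>v c = 0\<close>.\<close>
    have "v c' = 0" if "c' \<in> S \<times> {0} - {c}" for c'
    proof (rule ccontr)
      assume "v c' \<noteq> 0"
      then have "fst c' \<subseteq> fst c" using supp that c by blast
      then have "fst c' = fst c" using antichain[of "fst c'" "fst c"] that c by auto
      then show False using that c by (auto simp: prod_eq_iff)
    qed
    then have "(\<Sum>c'\<in>S \<times> {0} - {c}. v c') = 0" by (rule sum.neutral[rule_format])
    then show "v c = 0"
      using z sum.remove[OF _ c(1), of v] by simp
  qed
  have "\<exists>f. \<forall>n. P n (f n) \<and> Q (f n) (f (Suc n))"
  proof (rule dependent_nat_choice)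
    show "\<exists>x. P 0 x"
      by (rule exI[of _ "({({}, 0)}, S \<times> {0}, \<lambda>_ _. 1)"])
        (use ne start in \<open>auto simp: P_def\<close>)
  next
    fix x n assume Px: "P n x"
    obtain A C m where x: "x = (A, C, m)" by (rule prod_cases3)
    have C: "finite C" "label_independent A C m" using Px unfolding x P_def by auto
    obtain D m' where Dm: "finite D \<and> label_independent C D m' \<and>
      (\<forall>c\<in>C. \<forall>d\<in>D. m' c d \<noteq> 0 \<longrightarrow> fst c \<subset> fst d) \<and>
      (\<forall>b\<in>A. \<forall>d\<in>D. (\<Sum>c\<in>C. m b c * m' c d) = 0) \<and>
      (\<forall>W v. (\<forall>c\<in>C. v c \<noteq> 0 \<longrightarrow> fst c \<subseteq> W) \<longrightarrow> (\<forall>b\<in>A. (\<Sum>c\<in>C. m b c * v c) = 0) \<longrightarrow>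
       (\<exists>u. (\<forall>d\<in>D. u d \<noteq> 0 \<longrightarrow> fst d \<subseteq> W) \<and> (\<forall>c\<in>C. v c = (\<Sum>d\<in>D. m' c d * u d))))"
      using minimal_syzygies[OF C] by (elim exE)
    have "P (Suc n) (C, D, m')" unfolding P_def prod.case using C(1) Dm by simp
    moreover have "Q x (C, D, m')" unfolding Q_def x prod.case using Dm by (intro conjI refl; elim conjE)
    ultimately show "\<exists>y. P (Suc n) y \<and> Q x y" by blast
  qed
  then obtain f where P: "\<And>n. P n (f n)" and Q: "\<And>n. Q (f n) (f (Suc n))" by blast
  define B where "B n = fst (f n)" for n
  define l where "l n = snd (snd (f n))" for n
  have C: "fst (snd (f n)) = B (Suc n)" for n
    using Q[of n] unfolding Q_def B_def by (auto split: prod.splits)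
  have f: "f n = (B n, B (Suc n), l n)" for n
    by (rule prod_eqI) (simp_all add: C l_def B_def[of n] prod_eq_iff)
  note P' = P[unfolded f P_def prod.case]
  note Q' = Q[unfolded f Q_def prod.case]
  have "multigraded_resolution S B l"
  proof
    show "B 0 = {({}, 0)}" "B (Suc 0) = S \<times> {0}" using P'[of 0] by auto
    show "F \<in> S \<Longrightarrow> l 0 ({}, 0) (F, 0) = 1" for F using P'[of 0] by blast
    show "finite (B n)" for n using P'[of n] by blast
    show "b \<in> B n \<Longrightarrow> c \<in> B (Suc n) \<Longrightarrow> l n b c \<noteq> 0 \<Longrightarrow> fst b \<subset> fst c" for b c n
      using P'[of n] by blast
    show "\<exists>b\<in>B n. l n b c \<noteq> 0" if c: "c \<in> B (Suc n)" for c n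
    proof (rule ccontr)
      assume "\<not> (\<exists>b\<in>B n. l n b c \<noteq> 0)"
      then have z: "\<forall>b\<in>B n. (\<Sum>c'\<in>B (Suc n). l n b c' * (if c' = c then 1 else 0)) = 0"
        by (auto intro!: sum.neutral)
      \<comment> \<open>A zero column would make the unit vector at \<open>c\<close> a kernel vector
        of label \<open>fst c\<close>.\<close>
      have "label_independent (B n) (B (Suc n)) (l n)" using P'[of n] by blast
      note ind = this[unfolded label_independent_def, THEN spec, of "fst c", THEN spec,
        of "\<lambda>c'. if c' = c then 1 else 0"]
      have "(if c = c then 1 else 0 :: 'k) = 0"
        by (rule ind[THEN mp, THEN mp, THEN bspec, THEN mp]) (use z c in auto)
      then show False by simp
    qed
    show "(\<Sum>c\<in>B (Suc n). l n b c * l (Suc n) c d) = 0"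
      if "b \<in> B n" "d \<in> B (Suc (Suc n))" for b d n
      using Q'[of n] that by blast
    show "\<exists>u. (\<forall>d\<in>B (Suc (Suc n)). u d \<noteq> 0 \<longrightarrow> fst d \<subseteq> W) \<and>
         (\<forall>c\<in>B (Suc n). v c = (\<Sum>d\<in>B (Suc (Suc n)). l (Suc n) c d * u d))"
      if "\<And>c. c \<in> B (Suc n) \<Longrightarrow> v c \<noteq> 0 \<Longrightarrow> fst c \<subseteq> W"
       "\<And>b. b \<in> B n \<Longrightarrow> (\<Sum>c\<in>B (Suc n). l n b c * v c) = 0" for n v W
      by (rule Q'[of n, THEN conjunct2, THEN conjunct2, THEN spec, THEN spec, THEN mp, THEN mp])
        (use that in simp_all)
  qed
  then show thesis by (rule that)
qed

section \<open>Restriction to a vertex set\<close>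

context multigraded_resolution
begin

text \<open>Nonzero scalars lead only to smaller labels, so the elements with labels inside
  \<open>W\<close> form a subcomplex. It stays exact because exactness is known label by
  label.\<close>

lemma restrict: "multigraded_resolution {F\<in>S. F \<subseteq> W} (\<lambda>n. {b\<in>B n. fst b \<subseteq> W}) l"
proof
  show "{b \<in> B 0. fst b \<subseteq> W} = {({}, 0)}" unfolding B_0 by auto
  show "{b \<in> B (Suc 0). fst b \<subseteq> W} = {F \<in> S. F \<subseteq> W} \<times> {0}" unfolding B_1 by auto
  show "F \<in> {F \<in> S. F \<subseteq> W} \<Longrightarrow> l 0 ({}, 0) (F, 0) = 1" for F by (simp add: augmentation)
  show "finite {b \<in> B n. fst b \<subseteq> W}" for n using finite_B by simp
  show "b \<in> {b \<in> B n. fst b \<subseteq> W} \<Longrightarrow> c \<in> {b \<in> B (Suc n). fst b \<subseteq> W} \<Longrightarrow> l n b c \<noteq> 0 \<Longrightarrow>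
      fst b \<subset> fst c" for b c n
    using strict by blast
  show "\<exists>b\<in>{b \<in> B n. fst b \<subseteq> W}. l n b c \<noteq> 0" if c: "c \<in> {b \<in> B (Suc n). fst b \<subseteq> W}" for c n
  proof -
    obtain b where "b \<in> B n" "l n b c \<noteq> 0" using nonzero c by blast
    moreover from this have "fst b \<subset> fst c" using strict c by blast
    ultimately show ?thesis using c by blast
  qed
  show "(\<Sum>c\<in>{b \<in> B (Suc n). fst b \<subseteq> W}. l n b c * l (Suc n) c d) = 0"
    if b: "b \<in> {b \<in> B n. fst b \<subseteq> W}" and d: "d \<in> {b \<in> B (Suc (Suc n)). fst b \<subseteq> W}" for b d n
  proof -
    have "(\<Sum>c\<in>{b \<in> B (Suc n). fst b \<subseteq> W}. l n b c * l (Suc n) c d)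
        = (\<Sum>c\<in>B (Suc n). l n b c * l (Suc n) c d)"
    proof (rule sum.mono_neutral_left[OF finite_B])
      show "\<forall>c\<in>B (Suc n) - {b \<in> B (Suc n). fst b \<subseteq> W}. l n b c * l (Suc n) c d = 0"
      proof
        fix c assume c: "c \<in> B (Suc n) - {b \<in> B (Suc n). fst b \<subseteq> W}"
        then have "l (Suc n) c d = 0" using strict[of c "Suc n" d] d by blast
        then show "l n b c * l (Suc n) c d = 0" by simp
      qed
    qed auto
    then show ?thesis using complex b d by simp
  qed
  show "\<exists>u. (\<forall>d\<in>{b \<in> B (Suc (Suc n)). fst b \<subseteq> W}. u d \<noteq> 0 \<longrightarrow> fst d \<subseteq> W') \<and>
      (\<forall>c\<in>{b \<in> B (Suc n). fst b \<subseteq> W}. v c = (\<Sum>d\<in>{b \<in> B (Suc (Suc n)). fst b \<subseteq> W}. l (Suc n) c d * u d))"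
    if supp: "\<And>c. c \<in> {b \<in> B (Suc n). fst b \<subseteq> W} \<Longrightarrow> v c \<noteq> 0 \<Longrightarrow> fst c \<subseteq> W'"
      and z: "\<And>b. b \<in> {b \<in> B n. fst b \<subseteq> W} \<Longrightarrow> (\<Sum>c\<in>{b \<in> B (Suc n). fst b \<subseteq> W}. l n b c * v c) = 0"
    for n v W'
  proof -
    \<comment> \<open>The vector is extended by zero and exactness is used at
      \<open>W \<inter> W'\<close>, so that the coefficients found stay inside
      \<open>W\<close>.\<close>
    let ?v = "\<lambda>c. if fst c \<subseteq> W then v c else 0"
    have ext: "(\<Sum>c\<in>B (Suc n). l n b c * ?v c) = (\<Sum>c\<in>{b \<in> B (Suc n). fst b \<subseteq> W}. l n b c * v c)" for b
      by (rule sum.mono_neutral_cong_right[OF finite_B]) auto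
    have "\<exists>u. (\<forall>d\<in>B (Suc (Suc n)). u d \<noteq> 0 \<longrightarrow> fst d \<subseteq> W \<inter> W') \<and>
         (\<forall>c\<in>B (Suc n). ?v c = (\<Sum>d\<in>B (Suc (Suc n)). l (Suc n) c d * u d))"
    proof (rule exact)
      fix c assume "c \<in> B (Suc n)" "?v c \<noteq> 0"
      then show "fst c \<subseteq> W \<inter> W'" using supp[of c] by (simp split: if_splits)
    next
      fix b assume b: "b \<in> B n"
      show "(\<Sum>c\<in>B (Suc n). l n b c * ?v c) = 0"
      proof (cases "fst b \<subseteq> W")
        case True then show ?thesis unfolding ext using z b by blast
      next
        case False
        show ?thesis
        proof (rule sum.neutral, rule ballI)
          fix c assume c: "c \<in> B (Suc n)"
          show "l n b c * ?v c = 0"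
          proof (cases "l n b c = 0")
            case nz: False
            then have "fst b \<subset> fst c" using strict b c by blast
            then have "\<not> fst c \<subseteq> W" using False by blast
            then show ?thesis by simp
          qed simp
        qed
      qed
    qed
    then obtain u where u: "\<forall>d\<in>B (Suc (Suc n)). u d \<noteq> 0 \<longrightarrow> fst d \<subseteq> W \<inter> W'"
      "\<forall>c\<in>B (Suc n). ?v c = (\<Sum>d\<in>B (Suc (Suc n)). l (Suc n) c d * u d)" by (elim exE conjE)
    have "(\<Sum>d\<in>B (Suc (Suc n)). l (Suc n) c d * u d)
        = (\<Sum>d\<in>{b \<in> B (Suc (Suc n)). fst b \<subseteq> W}. l (Suc n) c d * u d)" for c
    proof (rule sum.mono_neutral_right[OF finite_B])
      show "\<forall>d\<in>B (Suc (Suc n)) - {b \<in> B (Suc (Suc n)). fst b \<subseteq> W}. l (Suc n) c d * u d = 0"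
      proof
        fix d assume "d \<in> B (Suc (Suc n)) - {b \<in> B (Suc (Suc n)). fst b \<subseteq> W}"
        then have "u d = 0" using u(1) by blast
        then show "l (Suc n) c d * u d = 0" by simp
      qed
    qed auto
    note eq = this
    show ?thesis
    proof (intro exI[of _ u] conjI ballI impI)
      fix d assume "d \<in> {b \<in> B (Suc (Suc n)). fst b \<subseteq> W}" "u d \<noteq> 0"
      then show "fst d \<subseteq> W'" using u(1) by blast
    next
      fix c assume c: "c \<in> {b \<in> B (Suc n). fst b \<subseteq> W}"
      then have "?v c = (\<Sum>d\<in>B (Suc (Suc n)). l (Suc n) c d * u d)"
        using bspec[OF u(2), of c] by blast
      then show "v c = (\<Sum>d\<in>{b \<in> B (Suc (Suc n)). fst b \<subseteq> W}. l (Suc n) c d * u d)"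
        using c unfolding eq by simp
    qed
  qed
qed

text \<open>Nonzero columns give a strictly descending chain of labels from position
  \<open>n\<close> to position 0.\<close>

lemma card_label_ge: "c \<in> B n \<Longrightarrow> n \<le> card (fst c)"
proof (induction n arbitrary: c)
  case (Suc n)
  then obtain b where b: "b \<in> B n" "l n b c \<noteq> 0" using nonzero by blast
  then have "card (fst b) < card (fst c)" using strict Suc.prems by (intro psubset_card_mono) auto
  then show ?case using Suc.IH[OF b(1)] by simp
qed simp

end

section \<open>Squarefree monomials and extraction of coefficients\<close>

definition set_monomial :: "'v set \<Rightarrow> 'v \<Rightarrow>\<^sub>0 nat" where
  "set_monomial W = (\<Sum>x\<in>W. Poly_Mapping.single x 1)"

lemma lookup_set_monomial:
  fixes W :: "'v::finite set"
  shows "Poly_Mapping.lookup (set_monomial W) x = (if x \<in> W then 1 else 0)"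
proof -
  have "Poly_Mapping.lookup (set_monomial W) x = (\<Sum>y\<in>W. if y = x then 1 else 0)"
    unfolding set_monomial_def lookup_sum by (rule sum.cong) (auto simp: lookup_single when_def)
  then show ?thesis by simp
qed

lemma keys_set_monomial: "Poly_Mapping.keys (set_monomial W) = W" for W :: "'v::finite set"
  by (auto simp: in_keys_iff lookup_set_monomial split: if_splits)

lemma mon_degree_set_monomial: "mon_degree (set_monomial W) = card W" for W :: "'v::finite set"
  by (simp add: mon_degree_def keys_set_monomial lookup_set_monomial)

lemma set_monomial_diff:
  fixes b c :: "'v::finite set"
  assumes "b \<subseteq> c"
  shows "set_monomial b + set_monomial (c - b) = set_monomial c"
  by (rule poly_mapping_eqI) (use assms in \<open>auto simp: lookup_add lookup_set_monomial\<close>)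

text \<open>Subtraction of exponents truncates at zero; the support condition rules this
  out.\<close>

lemma diff_set_monomial_add:
  fixes W :: "'v::finite set"
  assumes "W \<subseteq> Poly_Mapping.keys m"
  shows "m - set_monomial W + set_monomial W = m"
proof (rule poly_mapping_eqI)
  fix x
  have "x \<in> W \<Longrightarrow> Poly_Mapping.lookup m x \<noteq> 0" using assms by (auto simp: in_keys_iff)
  then show "Poly_Mapping.lookup (m - set_monomial W + set_monomial W) x = Poly_Mapping.lookup m x"
    by (auto simp: lookup_add lookup_minus lookup_set_monomial)
qed

lemma facet_monomial_eq:
  "facet_monomial F = Poly_Mapping.single (set_monomial F) (1 :: 'k::field)" for F :: "'v::finite set"
proof -
  have "(\<Prod>x\<in>F. Poly_Mapping.single (Poly_Mapping.single x 1) 1)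
      = Poly_Mapping.single (\<Sum>x\<in>F. Poly_Mapping.single x (1::nat)) (1 :: 'k)"
    using finite[of F] by (induction F rule: finite_induct) (auto simp: mult_single)
  then show ?thesis by (simp add: facet_monomial_def set_monomial_def)
qed

text \<open>The component of \<open>x\<^bsup>c\<^esup> p\<close> in the monomial \<open>m\<close>; passing to these components for
  all coordinates turns a matrix of scalars times monomials into the matrix of its scalars.\<close>

definition shifted_coeff :: "'v set \<Rightarrow> ('v, 'k::comm_ring_1) mpoly \<Rightarrow> ('v \<Rightarrow>\<^sub>0 nat) \<Rightarrow> 'k" where
  "shifted_coeff c p m =
     (if c \<subseteq> Poly_Mapping.keys m then Poly_Mapping.lookup p (m - set_monomial c) else 0)"

text \<open>If the support of \<open>m\<close> contains \<open>c\<close>, dividing by the monomials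
  of \<open>b\<close> and \<open>c - b\<close> is dividing by that of \<open>c\<close>. Otherwise
  the product has no such monomial, as it would put all of \<open>c\<close> into the support of
  \<open>m\<close>.\<close>

lemma lookup_monomial_mult_shifted:
  fixes b c :: "'v::finite set" and p :: "('v, 'k::comm_ring_1) mpoly"
  assumes "a \<noteq> 0 \<Longrightarrow> b \<subset> c" and b: "b \<subseteq> Poly_Mapping.keys m"
  shows "Poly_Mapping.lookup (Poly_Mapping.single (set_monomial (c - b)) a * p) (m - set_monomial b)
    = a * shifted_coeff c p m"
proof (cases "a = 0")
  case False
  then have bc: "b \<subseteq> c" using assms by blast
  show ?thesis
  proof (cases "c \<subseteq> Poly_Mapping.keys m")
    case True
    have "set_monomial b + (set_monomial (c - b) + (m - set_monomial c)) = m"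
      unfolding add.assoc[symmetric] set_monomial_diff[OF bc]
      using diff_set_monomial_add[OF True] by (simp add: add.commute)
    then have "m - set_monomial b = set_monomial (c - b) + (m - set_monomial c)"
      by (metis add_diff_cancel_left')
    then show ?thesis using True by (simp add: lookup_single_mult shifted_coeff_def)
  next
    case nc: False
    have "Poly_Mapping.lookup (Poly_Mapping.single (set_monomial (c - b)) a * p) (m - set_monomial b) = 0"
    proof (rule ccontr)
      assume "Poly_Mapping.lookup (Poly_Mapping.single (set_monomial (c - b)) a * p) (m - set_monomial b) \<noteq> 0"
      then obtain t n where t: "m - set_monomial b = t + n"
        "t \<in> Poly_Mapping.keys (Poly_Mapping.single (set_monomial (c - b)) a)" by (rule in_keys_multE)
      then have t': "t = set_monomial (c - b)" by (auto split: if_splits)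
      have "x \<in> Poly_Mapping.keys m" if x: "x \<in> c" for x
      proof (cases "x \<in> b")
        case False
        then have "Poly_Mapping.lookup (m - set_monomial b) x = 1 + Poly_Mapping.lookup n x"
          using x by (simp add: t(1) t' lookup_add lookup_set_monomial)
        then show ?thesis by (simp add: lookup_minus in_keys_iff)
      qed (use b in blast)
      then show False using nc by blast
    qed
    then show ?thesis using nc by (simp add: shifted_coeff_def)
  qed
qed simp

lemma sum_single: "(\<Sum>x\<in>X. Poly_Mapping.single t (f x)) = Poly_Mapping.single t (\<Sum>x\<in>X. f x)"
  by (induction X rule: infinite_finite_induct) (auto simp: single_add)

section \<open>The polynomial resolution given by the scalars\<close>

context multigraded_resolution
begin

definition basis_list :: "nat \<Rightarrow> ('v set \<times> nat) list" where
  "basis_list n = (SOME xs. distinct xs \<and> set xs = B n)"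

lemma basis_list: "distinct (basis_list n)" "set (basis_list n) = B n"
proof -
  have "\<exists>xs. distinct xs \<and> set xs = B n" using finite_distinct_list[OF finite_B[of n]] by blast
  from someI_ex[OF this] show "distinct (basis_list n)" "set (basis_list n) = B n"
    unfolding basis_list_def by blast+
qed

lemma basis_list_0: "basis_list 0 = [({}, 0)]"
proof -
  have "length (basis_list 0) = 1" using distinct_card[OF basis_list(1)[of 0]] by (simp add: basis_list B_0)
  then obtain x where "basis_list 0 = [x]" by (auto simp: length_Suc_conv)
  then show ?thesis using basis_list(2)[of 0] by (simp add: B_0)
qed

lemma nth_basis_list: "c < length (basis_list n) \<Longrightarrow> basis_list n ! c \<in> B n"
  using basis_list(2)[of n] by (metis nth_mem)

lemma bij_nth: "bij_betw ((!) (basis_list n)) {..<length (basis_list n)} (B n)"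
  using bij_betw_nth[OF basis_list(1) refl basis_list(2)[symmetric]] by simp

text \<open>Addressing coordinates by basis elements instead of list positions turns matrix products
  into sums over \<open>B n\<close>.\<close>

definition coord :: "nat \<Rightarrow> 'a vec \<Rightarrow> 'v set \<times> nat \<Rightarrow> 'a" where
  "coord n v b = v $ the_inv_into {..<length (basis_list n)} ((!) (basis_list n)) b"

lemma coord_nth: "c < length (basis_list n) \<Longrightarrow> coord n v (basis_list n ! c) = v $ c"
  using bij_nth[of n] by (simp add: coord_def bij_betw_def the_inv_into_f_f)

lemma B_E:
  assumes "b \<in> B n"
  obtains c where "c < length (basis_list n)" "b = basis_list n ! c"
  using assms basis_list(2)[of n] by (metis in_set_conv_nth)

lemma coord_vec: "b \<in> B n \<Longrightarrow> coord n (vec (length (basis_list n)) (\<lambda>c. f (basis_list n ! c))) b = f b"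
  by (elim B_E) (simp add: coord_nth)

lemma sum_coord:
  "(\<Sum>c<length (basis_list n). g (basis_list n ! c) (v $ c)) = (\<Sum>b\<in>B n. g b (coord n v b))"
proof -
  have "(\<Sum>c<length (basis_list n). g (basis_list n ! c) (v $ c))
      = (\<Sum>c<length (basis_list n). g (basis_list n ! c) (coord n v (basis_list n ! c)))"
    by (rule sum.cong) (simp_all add: coord_nth)
  also have "\<dots> = (\<Sum>b\<in>B n. g b (coord n v b))"
    by (rule sum.reindex_bij_betw[OF bij_nth])
  finally show ?thesis .
qed

lemma eq_vec_coord:
  assumes "v \<in> carrier_vec (length (basis_list n))" "w \<in> carrier_vec (length (basis_list n))"
    and "\<And>b. b \<in> B n \<Longrightarrow> coord n v b = coord n w b"
  shows "v = w"
proof (rule eq_vecI)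
  fix c assume "c < dim_vec w"
  then have c: "c < length (basis_list n)" using assms(2) by simp
  show "v $ c = w $ c" using assms(3)[OF nth_basis_list[OF c]] c by (simp add: coord_nth)
qed (use assms in simp)

definition differential :: "nat \<Rightarrow> ('v, 'k) mpoly mat" where
  "differential n = mat (length (basis_list n)) (length (basis_list (Suc n)))
     (\<lambda>(r, c). Poly_Mapping.single (set_monomial (fst (basis_list (Suc n) ! c) - fst (basis_list n ! r)))
       (l n (basis_list n ! r) (basis_list (Suc n) ! c)))"

lemma differential_carrier:
  "differential n \<in> carrier_mat (length (basis_list n)) (length (basis_list (Suc n)))"
  by (simp add: differential_def)

lemma coord_differential:
  assumes v: "v \<in> carrier_vec (length (basis_list (Suc n)))" and b: "b \<in> B n"
  shows "coord n (differential n *\<^sub>v v) b =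
    (\<Sum>c\<in>B (Suc n). Poly_Mapping.single (set_monomial (fst c - fst b)) (l n b c) * coord (Suc n) v c)"
proof -
  obtain r where r: "r < length (basis_list n)" "b = basis_list n ! r" using B_E[OF b] .
  have "coord n (differential n *\<^sub>v v) b = (differential n *\<^sub>v v) $ r"
    unfolding r(2) by (rule coord_nth[OF r(1)])
  also have "\<dots> = (\<Sum>c<length (basis_list (Suc n)). differential n $$ (r, c) * v $ c)"
    by (rule mult_mat_vec_index[OF differential_carrier v r(1)])
  also have "\<dots> = (\<Sum>c<length (basis_list (Suc n)).
      (\<lambda>c p. Poly_Mapping.single (set_monomial (fst c - fst b)) (l n b c) * p) (basis_list (Suc n) ! c) (v $ c))"
    by (rule sum.cong) (simp_all add: differential_def r)
  also have "\<dots> = (\<Sum>c\<in>B (Suc n). Poly_Mapping.single (set_monomial (fst c - fst b)) (l n b c) * coord (Suc n) v c)"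
    by (rule sum_coord)
  finally show ?thesis .
qed

lemma differential_carrier_vec:
  "v \<in> carrier_vec (length (basis_list (Suc n))) \<Longrightarrow> differential n *\<^sub>v v \<in> carrier_vec (length (basis_list n))"
  by (rule mult_mat_vec_carrier[OF differential_carrier])

text \<open>The monomials of two consecutive entries multiply to one that is independent of the
  middle label, so the scalar relation \<open>complex\<close> factors out.\<close>

lemma differential_differential:
  assumes w: "w \<in> carrier_vec (length (basis_list (Suc (Suc n))))"
  shows "differential n *\<^sub>v (differential (Suc n) *\<^sub>v w) = 0\<^sub>v (length (basis_list n))"
proof (rule eq_vec_coord)
  fix b assume b: "b \<in> B n"
  have comp: "Poly_Mapping.single (set_monomial (fst c - fst b)) (l n b c)
      * (Poly_Mapping.single (set_monomial (fst d - fst c)) (l (Suc n) c d) * p)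
      = Poly_Mapping.single (set_monomial (fst d - fst b)) (l n b c * l (Suc n) c d) * p"
    if c: "c \<in> B (Suc n)" and d: "d \<in> B (Suc (Suc n))" for c d and p :: "('v, 'k) mpoly"
  proof (cases "l n b c = 0 \<or> l (Suc n) c d = 0")
    case False
    then have "fst b \<subseteq> fst c" "fst c \<subseteq> fst d" using strict[OF b c] strict[OF c d] by blast+
    then have "set_monomial (fst c - fst b) + set_monomial (fst d - fst c) = set_monomial (fst d - fst b)"
      by (intro poly_mapping_eqI) (auto simp: lookup_add lookup_set_monomial)
    then show ?thesis by (simp add: mult_single flip: mult.assoc)
  qed auto
  have "coord n (differential n *\<^sub>v (differential (Suc n) *\<^sub>v w)) b
      = (\<Sum>c\<in>B (Suc n). \<Sum>d\<in>B (Suc (Suc n)).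
          Poly_Mapping.single (set_monomial (fst d - fst b)) (l n b c * l (Suc n) c d) * coord (Suc (Suc n)) w d)"
    unfolding coord_differential[OF differential_carrier_vec[OF w] b] sum_distrib_left
    by (simp add: coord_differential[OF w] sum_distrib_left comp)
  also have "\<dots> = (\<Sum>d\<in>B (Suc (Suc n)). \<Sum>c\<in>B (Suc n).
          Poly_Mapping.single (set_monomial (fst d - fst b)) (l n b c * l (Suc n) c d) * coord (Suc (Suc n)) w d)"
    by (rule sum.swap)
  also have "\<dots> = 0"
    by (rule sum.neutral) (simp add: sum_single complex[OF b] flip: sum_distrib_right)
  also have "0 = coord n (0\<^sub>v (length (basis_list n))) b"
    by (rule B_E[OF b]) (simp add: coord_nth)
  finally show "coord n (differential n *\<^sub>v (differential (Suc n) *\<^sub>v w)) b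
      = coord n (0\<^sub>v (length (basis_list n))) b" .
qed (use w in \<open>simp_all add: differential_carrier_vec\<close>)

text \<open>The problem splits over monomials \<open>m\<close>: the coefficients \<open>h m\<close>
  form a scalar syzygy with labels inside the support of \<open>m\<close>, which
  \<open>exact\<close> lifts. The lifts are reassembled into polynomials.\<close>

lemma differential_exact:
  assumes v: "v \<in> carrier_vec (length (basis_list (Suc n)))"
    and z: "differential n *\<^sub>v v = 0\<^sub>v (length (basis_list n))"
  obtains w where "w \<in> carrier_vec (length (basis_list (Suc (Suc n))))" "differential (Suc n) *\<^sub>v w = v"
proof -
  define h where "h m c = shifted_coeff (fst c) (coord (Suc n) v c) m" for m c
  have supp: "fst c \<subseteq> Poly_Mapping.keys m" if "h m c \<noteq> 0" for m c
    using that by (simp add: h_def shifted_coeff_def split: if_splits)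
  have kernel: "(\<Sum>c\<in>B (Suc n). l n b c * h m c) = 0" if b: "b \<in> B n" for b m
  proof (cases "fst b \<subseteq> Poly_Mapping.keys m")
    case True
    have "0 = Poly_Mapping.lookup (coord n (differential n *\<^sub>v v) b) (m - set_monomial (fst b))"
      unfolding z by (rule B_E[OF b]) (simp add: coord_nth)
    also have "\<dots> = (\<Sum>c\<in>B (Suc n). l n b c * h m c)"
      unfolding coord_differential[OF v b] lookup_sum h_def
      by (rule sum.cong[OF refl], rule lookup_monomial_mult_shifted[OF _ True]) (rule strict[OF b])
    finally show ?thesis by simp
  next
    case False
    show ?thesis
    proof (rule sum.neutral, rule ballI)
      fix c assume c: "c \<in> B (Suc n)"
      show "l n b c * h m c = 0"
      proof (rule ccontr)
        assume "l n b c * h m c \<noteq> 0"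
        then have "fst b \<subset> fst c" "fst c \<subseteq> Poly_Mapping.keys m" using strict[OF b c] supp by auto
        then show False using False by blast
      qed
    qed
  qed
  \<comment> \<open>Only the finitely many monomials in \<open>M\<close> carry a nonzero syzygy.
    Elsewhere the lift is chosen zero, so that the assembled coefficients have finite
    support.\<close>
  define M where "M = {m. \<exists>c\<in>B (Suc n). h m c \<noteq> 0}"
  have "M \<subseteq> (\<Union>c\<in>B (Suc n). (\<lambda>k. k + set_monomial (fst c)) ` Poly_Mapping.keys (coord (Suc n) v c))"
  proof
    fix m assume "m \<in> M"
    then obtain c where c: "c \<in> B (Suc n)" "h m c \<noteq> 0" unfolding M_def by blast
    then have "m - set_monomial (fst c) \<in> Poly_Mapping.keys (coord (Suc n) v c)"
      by (auto simp: h_def shifted_coeff_def in_keys_iff split: if_splits)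
    moreover have "m = m - set_monomial (fst c) + set_monomial (fst c)"
      using diff_set_monomial_add[OF supp[OF c(2)]] by simp
    ultimately show "m \<in> (\<Union>c\<in>B (Suc n). (\<lambda>k. k + set_monomial (fst c)) ` Poly_Mapping.keys (coord (Suc n) v c))"
      using c(1) by blast
  qed
  then have finM: "finite M" by (rule finite_subset) (simp add: finite_B)
  have "\<forall>m. \<exists>u. (\<forall>d\<in>B (Suc (Suc n)). u d \<noteq> 0 \<longrightarrow> fst d \<subseteq> Poly_Mapping.keys m) \<and>
      (\<forall>c\<in>B (Suc n). h m c = (\<Sum>d\<in>B (Suc (Suc n)). l (Suc n) c d * u d)) \<and> (m \<notin> M \<longrightarrow> u = (\<lambda>_. 0))"
  proof
    fix m
    show "\<exists>u. (\<forall>d\<in>B (Suc (Suc n)). u d \<noteq> 0 \<longrightarrow> fst d \<subseteq> Poly_Mapping.keys m) \<and>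
      (\<forall>c\<in>B (Suc n). h m c = (\<Sum>d\<in>B (Suc (Suc n)). l (Suc n) c d * u d)) \<and> (m \<notin> M \<longrightarrow> u = (\<lambda>_. 0))"
    proof (cases "m \<in> M")
      case True
      have "\<exists>u. (\<forall>d\<in>B (Suc (Suc n)). u d \<noteq> 0 \<longrightarrow> fst d \<subseteq> Poly_Mapping.keys m) \<and>
        (\<forall>c\<in>B (Suc n). h m c = (\<Sum>d\<in>B (Suc (Suc n)). l (Suc n) c d * u d))"
        by (rule exact) (rule supp, assumption, rule kernel)
      then show ?thesis using True by simp
    next
      case False
      then show ?thesis by (intro exI[of _ "\<lambda>_. 0"]) (auto simp: M_def)
    qed
  qed
  from choice[OF this] obtain U where "\<forall>m. (\<forall>d\<in>B (Suc (Suc n)). U m d \<noteq> 0 \<longrightarrow> fst d \<subseteq> Poly_Mapping.keys m) \<and>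
      (\<forall>c\<in>B (Suc n). h m c = (\<Sum>d\<in>B (Suc (Suc n)). l (Suc n) c d * U m d)) \<and> (m \<notin> M \<longrightarrow> U m = (\<lambda>_. 0))" ..
  then have U: "\<forall>d\<in>B (Suc (Suc n)). U m d \<noteq> 0 \<longrightarrow> fst d \<subseteq> Poly_Mapping.keys m"
      "\<forall>c\<in>B (Suc n). h m c = (\<Sum>d\<in>B (Suc (Suc n)). l (Suc n) c d * U m d)"
      "m \<notin> M \<Longrightarrow> U m = (\<lambda>_. 0)" for m by simp_all
  \<comment> \<open>The shift by the monomial of \<open>fst d\<close> undoes the division in
    \<open>shifted_coeff\<close>.\<close>
  define p where "p d = Abs_poly_mapping (\<lambda>k. U (k + set_monomial (fst d)) d)" for d
  have fin: "finite {k. U (k + set_monomial (fst d)) d \<noteq> 0}" for d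
  proof (rule finite_subset[OF _ finite_imageI[OF finM]])
    show "{k. U (k + set_monomial (fst d)) d \<noteq> 0} \<subseteq> (\<lambda>m. m - set_monomial (fst d)) ` M"
    proof
      fix k assume "k \<in> {k. U (k + set_monomial (fst d)) d \<noteq> 0}"
      then have "k + set_monomial (fst d) \<in> M" using U(3) by force
      then show "k \<in> (\<lambda>m. m - set_monomial (fst d)) ` M"
        by (rule rev_image_eqI) simp
    qed
  qed
  have lookup_p: "Poly_Mapping.lookup (p d) k = U (k + set_monomial (fst d)) d" for d k
    unfolding p_def by (simp add: fin)
  have sc: "shifted_coeff (fst d) (p d) m = U m d" if d: "d \<in> B (Suc (Suc n))" for d m
    using U(1)[of m] d by (auto simp: shifted_coeff_def lookup_p diff_set_monomial_add)
  define w where "w = vec (length (basis_list (Suc (Suc n)))) (\<lambda>i. p (basis_list (Suc (Suc n)) ! i))"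
  have w: "w \<in> carrier_vec (length (basis_list (Suc (Suc n))))" by (simp add: w_def)
  have "differential (Suc n) *\<^sub>v w = v"
  proof (rule eq_vec_coord[OF differential_carrier_vec[OF w] v], rule poly_mapping_eqI)
    fix c k assume c: "c \<in> B (Suc n)"
    \<comment> \<open>Each exponent \<open>k\<close> of coordinate \<open>c\<close> is seen in the
      component \<open>?m\<close>, so all coefficients get compared.\<close>
    let ?m = "k + set_monomial (fst c)"
    have keys: "fst c \<subseteq> Poly_Mapping.keys ?m" by (auto simp: in_keys_iff lookup_add lookup_set_monomial)
    have "Poly_Mapping.lookup (coord (Suc n) (differential (Suc n) *\<^sub>v w) c) (?m - set_monomial (fst c))
       = (\<Sum>d\<in>B (Suc (Suc n)). l (Suc n) c d * U ?m d)"
      unfolding coord_differential[OF w c] lookup_sum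
    proof (rule sum.cong[OF refl])
      fix d assume d: "d \<in> B (Suc (Suc n))"
      have "coord (Suc (Suc n)) w d = p d" unfolding w_def by (rule coord_vec[OF d])
      then show "Poly_Mapping.lookup (Poly_Mapping.single (set_monomial (fst d - fst c)) (l (Suc n) c d)
          * coord (Suc (Suc n)) w d) (?m - set_monomial (fst c)) = l (Suc n) c d * U ?m d"
        using lookup_monomial_mult_shifted[OF strict[OF c d] keys, of _ "p d"] sc[OF d, of ?m] by simp
    qed
    also have "\<dots> = h ?m c" using U(2) c by simp
    also have "\<dots> = Poly_Mapping.lookup (coord (Suc n) v c) k"
      using keys by (simp add: h_def shifted_coeff_def)
    finally show "Poly_Mapping.lookup (coord (Suc n) (differential (Suc n) *\<^sub>v w) c) k
        = Poly_Mapping.lookup (coord (Suc n) v c) k" by simp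
  qed
  then show thesis using w that by blast
qed

lemma graded_differential:
  "graded_mat (map (card \<circ> fst) (basis_list (Suc n))) (map (card \<circ> fst) (basis_list n)) (differential n)"
  unfolding graded_mat_def
proof (intro conjI allI impI ballI)
  fix r c m
  assume "r < length (map (card \<circ> fst) (basis_list n))" "c < length (map (card \<circ> fst) (basis_list (Suc n)))"
  then have r: "r < length (basis_list n)" and c: "c < length (basis_list (Suc n))" by simp_all
  let ?b = "basis_list n ! r" and ?c = "basis_list (Suc n) ! c"
  assume "m \<in> Poly_Mapping.keys (differential n $$ (r, c))"
  then have "m = set_monomial (fst ?c - fst ?b)" "l n ?b ?c \<noteq> 0"
    using r c by (auto simp: differential_def split: if_splits)
  moreover from this have "fst ?b \<subseteq> fst ?c"
    using strict[OF nth_basis_list[OF r] nth_basis_list[OF c]] by blast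
  ultimately show "mon_degree m + map (card \<circ> fst) (basis_list n) ! r = map (card \<circ> fst) (basis_list (Suc n)) ! c"
    using r c by (simp add: mon_degree_set_monomial card_Diff_subset card_mono)
qed (use differential_carrier in simp_all)

lemma image_differential_0:
  "mat_image (differential 0) = {v \<in> carrier_vec 1. v $ 0 \<in> Modules.module.span (*) (facet_monomial ` S)}"
proof -
  interpret poly: Modules.module "(*) :: ('v, 'k) mpoly \<Rightarrow> _"
    by unfold_locales (auto simp: algebra_simps)
  \<comment> \<open>Sums over the set of generators are exchanged with sums over \<open>S\<close>
    below.\<close>
  have inj: "inj_on (facet_monomial :: _ \<Rightarrow> ('v, 'k) mpoly) S"
  proof (rule inj_onI)
    fix F G assume "(facet_monomial F :: ('v, 'k) mpoly) = facet_monomial G"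
    from arg_cong[OF this, of Poly_Mapping.keys] have "set_monomial F = set_monomial G"
      by (simp add: facet_monomial_eq)
    then show "F = G" using keys_set_monomial by metis
  qed
  have entry: "(differential 0 *\<^sub>v v) $ 0 = (\<Sum>F\<in>S. coord (Suc 0) v (F, 0) * facet_monomial F)"
    if v: "v \<in> carrier_vec (length (basis_list (Suc 0)))" for v
  proof -
    have "(differential 0 *\<^sub>v v) $ 0 = coord 0 (differential 0 *\<^sub>v v) ({}, 0)"
      using coord_nth[of 0 0 "differential 0 *\<^sub>v v"] by (simp add: basis_list_0)
    also have "\<dots> = (\<Sum>c\<in>S \<times> {0}. Poly_Mapping.single (set_monomial (fst c)) (l 0 ({}, 0) c) * coord (Suc 0) v c)"
      using coord_differential[OF v, of "({}, 0)"] by (simp add: B_0 B_1)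
    also have "S \<times> {0} = (\<lambda>F. (F, 0)) ` S" by auto
    also have "(\<Sum>c\<in>(\<lambda>F. (F, 0)) ` S. Poly_Mapping.single (set_monomial (fst c)) (l 0 ({}, 0) c) * coord (Suc 0) v c)
        = (\<Sum>F\<in>S. Poly_Mapping.single (set_monomial F) (l 0 ({}, 0) (F, 0)) * coord (Suc 0) v (F, 0))"
      by (subst sum.reindex) (auto simp: inj_on_def)
    also have "\<dots> = (\<Sum>F\<in>S. coord (Suc 0) v (F, 0) * facet_monomial F)"
      by (rule sum.cong) (simp_all add: augmentation facet_monomial_eq mult.commute)
    finally show ?thesis .
  qed
  have dim: "dim_col (differential 0) = length (basis_list (Suc 0))" by (simp add: differential_def)
  have row: "dim_row (differential 0) = 1" by (simp add: differential_def basis_list_0)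
  show ?thesis
  proof (intro equalityI subsetI)
    fix x assume "x \<in> mat_image (differential 0)"
    then obtain v where v: "v \<in> carrier_vec (length (basis_list (Suc 0)))" "x = differential 0 *\<^sub>v v"
      unfolding mat_image_def dim by blast
    have "x $ 0 \<in> poly.span (facet_monomial ` S)"
      unfolding v(2) entry[OF v(1)] by (intro poly.span_sum poly.span_scale poly.span_base) simp
    moreover have "x \<in> carrier_vec 1"
      using differential_carrier_vec[OF v(1)] unfolding v(2) basis_list_0 by simp
    ultimately show "x \<in> {v \<in> carrier_vec 1. v $ 0 \<in> poly.span (facet_monomial ` S)}" by blast
  next
    fix x :: "('v, 'k) mpoly vec"
    assume "x \<in> {v \<in> carrier_vec 1. v $ 0 \<in> poly.span (facet_monomial ` S)}"
    then have x: "x \<in> carrier_vec 1" "x $ 0 \<in> poly.span (facet_monomial ` S)" by auto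
    have "finite (facet_monomial ` S :: ('v, 'k) mpoly set)" by simp
    from x(2)[unfolded poly.span_finite[OF this]]
    obtain u where "x $ 0 = (\<Sum>a\<in>facet_monomial ` S. u a * a)" by blast
    then have u: "x $ 0 = (\<Sum>F\<in>S. u (facet_monomial F) * facet_monomial F)"
      by (simp add: sum.reindex[OF inj])
    define v where "v = vec (length (basis_list (Suc 0))) (\<lambda>c. u (facet_monomial (fst (basis_list (Suc 0) ! c))))"
    have v: "v \<in> carrier_vec (length (basis_list (Suc 0)))" by (simp add: v_def)
    have "coord (Suc 0) v (F, 0) = u (facet_monomial F)" if "F \<in> S" for F
      unfolding v_def using coord_vec[of "(F, 0)" "Suc 0" "\<lambda>b. u (facet_monomial (fst b))"] that
      by (simp add: B_1)
    then have "(differential 0 *\<^sub>v v) $ 0 = x $ 0" unfolding entry[OF v] u by (intro sum.cong) auto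
    then have "differential 0 *\<^sub>v v = x" using x(1) row by (intro eq_vecI) auto
    then show "x \<in> mat_image (differential 0)" unfolding mat_image_def dim using v by blast
  qed
qed

text \<open>Position \<open>i + 1\<close> is homological degree \<open>i\<close>, since position 0
  is \<open>R\<close>. The resolution is minimal because labels grow strictly, so that nonzero
  entries are nonconstant monomials.\<close>

theorem minimal_graded_free_resolution_differential:
  "minimal_graded_free_resolution (Modules.module.span (*) (facet_monomial ` S))
     (\<lambda>i. map (card \<circ> fst) (basis_list (Suc i))) differential"
  unfolding minimal_graded_free_resolution_def graded_hom_iff_graded_mat
proof (intro conjI allI impI)
  show "graded_mat (map (card \<circ> fst) (basis_list (Suc 0))) [0] (differential 0)"
    using graded_differential[of 0] by (simp add: basis_list_0)
  show "graded_mat (map (card \<circ> fst) (basis_list (Suc (Suc i)))) (map (card \<circ> fst) (basis_list (Suc i)))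
      (differential (Suc i))" for i by (rule graded_differential)
  show "mat_image (differential 0) = {v \<in> carrier_vec 1. v $ 0 \<in> Modules.module.span (*) (facet_monomial ` S)}"
    by (rule image_differential_0)
  have dim: "dim_col (differential n) = length (basis_list (Suc n))" "dim_row (differential n) = length (basis_list n)"
    for n using differential_carrier[of n] by auto
  show "mat_image (differential (Suc i)) = mat_kernel (differential i)" for i
  proof (intro equalityI subsetI)
    fix x assume "x \<in> mat_image (differential (Suc i))"
    then obtain w where "w \<in> carrier_vec (length (basis_list (Suc (Suc i))))" "x = differential (Suc i) *\<^sub>v w"
      unfolding mat_image_def dim by blast
    then show "x \<in> mat_kernel (differential i)"
      unfolding mat_kernel_def dim by (simp add: differential_differential differential_carrier_vec)
  next
    fix x assume "x \<in> mat_kernel (differential i)"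
    then have x: "x \<in> carrier_vec (length (basis_list (Suc i)))"
      "differential i *\<^sub>v x = 0\<^sub>v (length (basis_list i))" by (simp_all add: mat_kernel_def dim)
    obtain w where "w \<in> carrier_vec (length (basis_list (Suc (Suc i))))" "differential (Suc i) *\<^sub>v w = x"
      by (rule differential_exact[OF x])
    then show "x \<in> mat_image (differential (Suc i))" unfolding mat_image_def dim by blast
  qed
  fix i r c
  assume "r < length (map (card \<circ> fst) (basis_list (Suc i)))" "c < length (map (card \<circ> fst) (basis_list (Suc (Suc i))))"
  then have r: "r < length (basis_list (Suc i))" and c: "c < length (basis_list (Suc (Suc i)))" by simp_all
  let ?b = "basis_list (Suc i) ! r" and ?c = "basis_list (Suc (Suc i)) ! c"
  have "l (Suc i) ?b ?c = 0 \<or> set_monomial (fst ?c - fst ?b) \<noteq> 0"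
  proof (rule disjCI)
    assume "\<not> set_monomial (fst ?c - fst ?b) \<noteq> 0"
    then have "fst ?c - fst ?b = {}" using keys_set_monomial[of "fst ?c - fst ?b"] by simp
    then show "l (Suc i) ?b ?c = 0" using strict[OF nth_basis_list[OF r] nth_basis_list[OF c]] by blast
  qed
  then show "Poly_Mapping.lookup (differential (Suc i) $$ (r, c)) 0 = 0"
    using r c by (auto simp: differential_def lookup_single)
qed

corollary betti_eq_card_labels:
  "betti (Modules.module.span (*) (facet_monomial ` S) :: ('v, 'k) mpoly set) i j
    = card {c \<in> B (Suc i). card (fst c) = j}"
proof -
  have "betti (Modules.module.span (*) (facet_monomial ` S) :: ('v, 'k) mpoly set) i j
      = length (filter (\<lambda>c. card (fst c) = j) (basis_list (Suc i)))"
    unfolding betti_eq_count_list[OF minimal_graded_free_resolution_differential]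
    by (simp add: count_list_eq_length_filter filter_map comp_def eq_commute[of j])
  also have "\<dots> = card (set (filter (\<lambda>c. card (fst c) = j) (basis_list (Suc i))))"
    using basis_list(1) by (intro distinct_card[symmetric]) simp
  finally show ?thesis by (simp add: basis_list)
qed

end

section \<open>Betti numbers of clutters\<close>

definition clutter :: "'v set set \<Rightarrow> bool" where
  "clutter S \<longleftrightarrow> {} \<notin> S \<and> (\<forall>F\<in>S. \<forall>G\<in>S. F \<subseteq> G \<longrightarrow> F = G)"

lemma clutter_subset: "T \<subseteq> S \<Longrightarrow> clutter S \<Longrightarrow> clutter T"
  unfolding clutter_def by (metis subsetD)

text \<open>Taking generating sets instead of complexes covers the families
  \<open>{F\<in>S. F \<subseteq> W}\<close> directly, even when empty.\<close>

definition clutter_betti :: "'k::field itself \<Rightarrow> 'v set set \<Rightarrow> nat \<Rightarrow> nat \<Rightarrow> nat" where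
  "clutter_betti _ S = betti (Modules.module.span (*) (facet_monomial ` S) :: ('v, 'k) mpoly set)"

lemma betti_facet_ideal: "betti (facet_ideal TYPE('k::field) \<Gamma>) = clutter_betti TYPE('k) (facets \<Gamma>)"
  by (simp add: facet_ideal_def clutter_betti_def)

lemma ex_resolution_of_clutter:
  fixes S :: "'v::finite set set"
  assumes "clutter S"
  obtains B and l :: "nat \<Rightarrow> 'v set \<times> nat \<Rightarrow> 'v set \<times> nat \<Rightarrow> 'k::field"
  where "multigraded_resolution S B l"
  by (rule ex_multigraded_resolution[of S]) (use assms in \<open>auto simp: clutter_def\<close>)

lemma (in multigraded_resolution) clutter_betti_eq:
  "clutter_betti TYPE('k) S i j = card {c \<in> B (Suc i). card (fst c) = j}"
  unfolding clutter_betti_def by (rule betti_eq_card_labels)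

lemma (in multigraded_resolution) clutter_betti_restrict:
  "clutter_betti TYPE('k) {F\<in>S. F \<subseteq> W} i j = card {c \<in> B (Suc i). fst c \<subseteq> W \<and> card (fst c) = j}"
  using multigraded_resolution.clutter_betti_eq[OF restrict, of W i j] by simp

text \<open>A label inside \<open>W\<close> of full cardinality is \<open>W\<close>. Hence the Betti
  number at multidegree \<open>W\<close> is an ordinary one of the facets inside \<open>W\<close>,
  independent of the resolution.\<close>

lemma (in multigraded_resolution) clutter_betti_restrict_card:
  "clutter_betti TYPE('k) {F\<in>S. F \<subseteq> W} i (card W) = card {c \<in> B (Suc i). fst c = W}"
proof -
  have "fst c \<subseteq> W \<and> card (fst c) = card W \<longleftrightarrow> fst c = W" for c :: "'v set \<times> nat"
    using card_subset_eq[of W "fst c"] by auto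
  then have "{c \<in> B (Suc i). fst c \<subseteq> W \<and> card (fst c) = card W} = {c \<in> B (Suc i). fst c = W}"
    by simp
  then show ?thesis by (simp only: clutter_betti_restrict)
qed

text \<open>Basis elements are sorted by their labels, the multidegrees.\<close>

lemma clutter_betti_sum:
  fixes S :: "'v::finite set set"
  assumes "clutter S"
  shows "clutter_betti TYPE('k::field) S i j
    = (\<Sum>W | card W = j. clutter_betti TYPE('k) {F\<in>S. F \<subseteq> W} i j)"
proof -
  obtain B and l :: "nat \<Rightarrow> 'v set \<times> nat \<Rightarrow> 'v set \<times> nat \<Rightarrow> 'k" where "multigraded_resolution S B l"
    by (rule ex_resolution_of_clutter[OF assms])
  then interpret multigraded_resolution S B l .
  have "{c \<in> B (Suc i). card (fst c) = j} = (\<Union>W\<in>{W. card W = j}. {c \<in> B (Suc i). fst c = W})"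
    by auto
  then have "clutter_betti TYPE('k) S i j = (\<Sum>W | card W = j. card {c \<in> B (Suc i). fst c = W})"
    unfolding clutter_betti_eq by (simp only:) (rule card_UN_disjoint; use finite_B in auto)
  also have "\<dots> = (\<Sum>W | card W = j. clutter_betti TYPE('k) {F\<in>S. F \<subseteq> W} i j)"
    by (rule sum.cong) (auto simp: clutter_betti_restrict_card)
  finally show ?thesis .
qed

text \<open>The union \<open>W'\<close> of the facets inside \<open>W\<close> contains the same
  facets as \<open>W\<close>, so the Betti number is also counted by labels inside
  \<open>W'\<close>. One of cardinality \<open>card W\<close> forces \<open>W' = W\<close>.\<close>

lemma clutter_betti_nonzeroD:
  fixes S :: "'v::finite set set"
  assumes S: "clutter S" and nz: "clutter_betti TYPE('k::field) {F\<in>S. F \<subseteq> W} i (card W) \<noteq> 0"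
  shows "W \<noteq> {}" "W = \<Union>{F\<in>S. F \<subseteq> W}"
proof -
  obtain B and l :: "nat \<Rightarrow> 'v set \<times> nat \<Rightarrow> 'v set \<times> nat \<Rightarrow> 'k" where "multigraded_resolution S B l"
    by (rule ex_resolution_of_clutter[OF S])
  then interpret multigraded_resolution S B l .
  have "{c \<in> B (Suc i). fst c = W} \<noteq> {}" using nz unfolding clutter_betti_restrict_card by force
  then obtain c where "c \<in> B (Suc i)" "fst c = W" by blast
  \<comment> \<open>The position is \<open>Suc i\<close>, so the label has at least one
    vertex.\<close>
  then show "W \<noteq> {}" using card_label_ge by fastforce
  define W' where "W' = \<Union>{F\<in>S. F \<subseteq> W}"
  have eq: "{F\<in>S. F \<subseteq> W'} = {F\<in>S. F \<subseteq> W}" unfolding W'_def by blast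
  have "clutter_betti TYPE('k) {F\<in>S. F \<subseteq> W'} i (card W) \<noteq> 0" using nz eq by simp
  then have "{c \<in> B (Suc i). fst c \<subseteq> W' \<and> card (fst c) = card W} \<noteq> {}"
    unfolding clutter_betti_restrict by force
  then obtain c :: "'v set \<times> nat" where c: "fst c \<subseteq> W'" "card (fst c) = card W" by blast
  have "card W \<le> card W'" using card_mono[OF finite c(1)] c(2) by simp
  moreover have "W' \<subseteq> W" unfolding W'_def by blast
  ultimately show "W = W'" using card_seteq[of W W'] by simp
qed

text \<open>Positions are bounded by label sizes. This makes the sets in \<open>projdim\<close> and
  \<open>reg\<close> finite.\<close>

lemma clutter_betti_bounded:
  fixes S :: "'v::finite set set"
  assumes S: "clutter S" and nz: "clutter_betti TYPE('k::field) S i j \<noteq> 0"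
  shows "i \<le> card (UNIV :: 'v set)" "j \<le> card (UNIV :: 'v set)"
proof -
  obtain B and l :: "nat \<Rightarrow> 'v set \<times> nat \<Rightarrow> 'v set \<times> nat \<Rightarrow> 'k" where "multigraded_resolution S B l"
    by (rule ex_resolution_of_clutter[OF S])
  then interpret multigraded_resolution S B l .
  have "{c \<in> B (Suc i). card (fst c) = j} \<noteq> {}" using nz unfolding clutter_betti_eq by force
  then obtain c where c: "c \<in> B (Suc i)" "card (fst c) = j" by blast
  have "card (fst c) \<le> card (UNIV :: 'v set)" by (rule card_mono) auto
  then show "i \<le> card (UNIV :: 'v set)" "j \<le> card (UNIV :: 'v set)" using card_label_ge[OF c(1)] c(2) by simp_all
qed

text \<open>The facets label position 1. This makes the sets in \<open>projdim\<close> and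
  \<open>reg\<close> nonempty.\<close>

lemma clutter_betti_0_nonzero:
  fixes S :: "'v::finite set set"
  assumes S: "clutter S" and F: "F \<in> S"
  shows "clutter_betti TYPE('k::field) S 0 (card F) \<noteq> 0"
proof -
  obtain B and l :: "nat \<Rightarrow> 'v set \<times> nat \<Rightarrow> 'v set \<times> nat \<Rightarrow> 'k" where "multigraded_resolution S B l"
    by (rule ex_resolution_of_clutter[OF S])
  then interpret multigraded_resolution S B l .
  have "(F, 0) \<in> {c \<in> B (Suc 0). card (fst c) = card F}" using F by (simp add: B_1)
  then show ?thesis unfolding clutter_betti_eq using finite_B[of "Suc 0"] by (auto simp: card_eq_0_iff)
qed

text \<open>A subset \<open>W\<close> carrying a nonzero multigraded Betti number of one of the pieces sees no facet
  outside this piece, so the multigraded Betti numbers of the pieces at \<open>W\<close> do not compete.\<close>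

lemma clutter_betti_superadditive:
  fixes S :: "'v::finite set set"
  assumes S: "clutter S" and fin: "finite I" and sub: "\<And>t. t \<in> I \<Longrightarrow> T t \<subseteq> S"
    and disj: "\<And>t u. t \<in> I \<Longrightarrow> u \<in> I \<Longrightarrow> t \<noteq> u \<Longrightarrow> T t \<inter> T u = {}"
    and closed: "\<And>t W. t \<in> I \<Longrightarrow> W \<noteq> {} \<Longrightarrow> W = \<Union>{F\<in>T t. F \<subseteq> W} \<Longrightarrow> {F\<in>S. F \<subseteq> W} \<subseteq> T t"
  shows "(\<Sum>t\<in>I. clutter_betti TYPE('k::field) (T t) i j) \<le> clutter_betti TYPE('k) S i j"
proof -
  have T: "clutter (T t)" if "t \<in> I" for t by (rule clutter_subset[OF sub[OF that] S])
  have "(\<Sum>t\<in>I. clutter_betti TYPE('k) (T t) i j)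
      = (\<Sum>t\<in>I. \<Sum>W | card W = j. clutter_betti TYPE('k) {F\<in>T t. F \<subseteq> W} i j)"
    by (rule sum.cong) (simp_all add: clutter_betti_sum T)
  also have "\<dots> = (\<Sum>W | card W = j. \<Sum>t\<in>I. clutter_betti TYPE('k) {F\<in>T t. F \<subseteq> W} i j)"
    by (rule sum.swap)
  also have "\<dots> \<le> (\<Sum>W | card W = j. clutter_betti TYPE('k) {F\<in>S. F \<subseteq> W} i j)"
  proof (rule sum_mono)
    fix W :: "'v set" assume "W \<in> {W. card W = j}"
    then have j: "j = card W" by simp
    show "(\<Sum>t\<in>I. clutter_betti TYPE('k) {F\<in>T t. F \<subseteq> W} i j) \<le> clutter_betti TYPE('k) {F\<in>S. F \<subseteq> W} i j"
    proof (cases "\<exists>t\<in>I. clutter_betti TYPE('k) {F\<in>T t. F \<subseteq> W} i j \<noteq> 0")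
      case True
      then obtain t where t: "t \<in> I" "clutter_betti TYPE('k) {F\<in>T t. F \<subseteq> W} i j \<noteq> 0" by blast
      \<comment> \<open>\<open>W\<close> is a nonempty union of facets of \<open>T t\<close>, so
        \<open>closed\<close> applies, and pieces disjoint from \<open>T t\<close> have no facet
        inside \<open>W\<close>.\<close>
      note W = clutter_betti_nonzeroD[OF T[OF t(1)] t(2)[unfolded j]]
      have "{F\<in>S. F \<subseteq> W} \<subseteq> T t" by (rule closed[OF t(1) W])
      then have St: "{F\<in>S. F \<subseteq> W} = {F\<in>T t. F \<subseteq> W}" using sub[OF t(1)] by blast
      have "clutter_betti TYPE('k) {F\<in>T u. F \<subseteq> W} i j = 0" if u: "u \<in> I - {t}" for u
      proof (rule ccontr)
        assume nz: "clutter_betti TYPE('k) {F\<in>T u. F \<subseteq> W} i j \<noteq> 0"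
        have uI: "u \<in> I" using u by blast
        have "W = \<Union>{F\<in>T u. F \<subseteq> W}" by (rule clutter_betti_nonzeroD(2)[OF T[OF uI] nz[unfolded j]])
        then obtain F where "F \<in> T u" "F \<subseteq> W" using W(1) by blast
        moreover from this have "F \<in> T t" using sub[OF uI] St by blast
        ultimately show False using disj[OF t(1) uI] u by blast
      qed
      then have "(\<Sum>u\<in>I - {t}. clutter_betti TYPE('k) {F\<in>T u. F \<subseteq> W} i j) = 0"
        by (rule sum.neutral[rule_format])
      then have "(\<Sum>t\<in>I. clutter_betti TYPE('k) {F\<in>T t. F \<subseteq> W} i j)
          = clutter_betti TYPE('k) {F\<in>T t. F \<subseteq> W} i j"
        by (subst sum.remove[OF fin t(1)]) simp
      then show ?thesis by (simp add: St)
    qed simp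
  qed
  also have "\<dots> = clutter_betti TYPE('k) S i j" by (rule clutter_betti_sum[OF S, symmetric])
  finally show ?thesis .
qed

section \<open>Facets of simplicial forests\<close>

lemma facets_generated_complex:
  assumes "\<And>F G. F \<in> A \<Longrightarrow> G \<in> A \<Longrightarrow> F \<subseteq> G \<Longrightarrow> F = G"
  shows "facets (generated_complex A) = A"
proof (intro equalityI subsetI)
  fix F assume "F \<in> facets (generated_complex A)"
  then obtain G where "G \<in> A" "F \<subseteq> G" "G \<in> generated_complex A \<Longrightarrow> F \<subseteq> G \<Longrightarrow> G = F"
    by (auto simp: facets_def generated_complex_def)
  moreover from this have "G \<in> generated_complex A" by (auto simp: generated_complex_def)
  ultimately show "F \<in> A" by simp
next
  fix F assume F: "F \<in> A"
  have "G = F" if G: "G \<in> generated_complex A" "F \<subseteq> G" for G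
  proof -
    obtain H where "H \<in> A" "G \<subseteq> H" using G(1) by (auto simp: generated_complex_def)
    then show ?thesis using assms[OF F, of H] G(2) by blast
  qed
  then show "F \<in> facets (generated_complex A)"
    using F by (auto simp: facets_def generated_complex_def)
qed

text \<open>None of the three facets is a leaf of the subcollection they form: a joint would be one
  of the other two and would contain the vertex shared only with the third.\<close>

lemma no_special_triangle:
  fixes \<Delta> :: "'v::finite set set"
  assumes forest: "simplicial_forest \<Delta>" and facets: "F \<in> facets \<Delta>" "G \<in> facets \<Delta>" "H \<in> facets \<Delta>"
    and x: "x \<in> F \<inter> G" "x \<notin> H" and y: "y \<in> F \<inter> H" "y \<notin> G" and z: "z \<in> G \<inter> H" "z \<notin> F"
  shows False
proof -
  let ?\<Gamma> = "generated_complex {F, G, H}"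
  have antichain: "A = B" if "A \<in> facets \<Delta>" "B \<in> facets \<Delta>" "A \<subseteq> B" for A B
    using that unfolding facets_def by blast
  have fac: "facets ?\<Gamma> = {F, G, H}"
    by (rule facets_generated_complex) (use facets antichain in blast)
  have "simplicial_complex_on (\<Union>?\<Gamma>) ?\<Gamma>"
    unfolding simplicial_complex_on_def generated_complex_def by auto
  then have "subcollection ?\<Gamma> \<Delta>" using fac facets by (simp add: subcollection_def)
  moreover have "?\<Gamma> \<noteq> {}" unfolding generated_complex_def by blast
  ultimately obtain L where "leaf L ?\<Gamma>" using forest unfolding simplicial_forest_def by blast
  moreover have "F \<noteq> G" "F \<noteq> H" "G \<noteq> H" using x y z by auto
  ultimately show False unfolding leaf_def fac using x y z by blast
qed

text \<open>All facets of \<open>T\<close> share the vertex \<open>x\<close>, so by the previous lemma the traces on \<open>H\<close> of any two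
  of them are comparable.\<close>

lemma covered_facet_meets_center:
  fixes \<Delta> :: "'v::finite set set"
  assumes forest: "simplicial_forest \<Delta>" and T: "T \<subseteq> facets \<Delta>" "T \<noteq> {}" and H: "H \<in> facets \<Delta>"
    and cover: "H \<subseteq> \<Union>T" and x: "\<And>G. G \<in> T \<Longrightarrow> x \<in> G"
  shows "x \<in> H"
proof (rule ccontr)
  assume xH: "x \<notin> H"
  \<comment> \<open>\<open>G\<close> has the largest trace on \<open>H\<close>. If it misses
    \<open>z\<close>, some \<open>G'\<close> contains \<open>z\<close>, and by maximality
    \<open>G'\<close> misses some \<open>y\<close> of the trace of \<open>G\<close>. Then
    \<open>x\<close>, \<open>y\<close>, \<open>z\<close> span a special triangle.\<close>
  obtain G where G: "G \<in> T" "\<And>G'. G' \<in> T \<Longrightarrow> card (H \<inter> G') \<le> card (H \<inter> G)"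
  proof -
    let ?f = "\<lambda>G. card (H \<inter> G)"
    have "Max (?f ` T) \<in> ?f ` T" using T by (intro Max_in) auto
    then obtain G where "G \<in> T" "?f G = Max (?f ` T)" by fastforce
    moreover from this have "?f G' \<le> ?f G" if "G' \<in> T" for G' using that by simp
    ultimately show thesis using that by blast
  qed
  show False
  proof (cases "H \<subseteq> G")
    case True
    then have "H = G" using H G(1) T(1) unfolding facets_def by blast
    then show False using x[OF G(1)] xH by simp
  next
    case False
    then obtain z where z: "z \<in> H" "z \<notin> G" by blast
    then obtain G' where G': "G' \<in> T" "z \<in> G'" using cover by blast
    have "\<not> H \<inter> G \<subseteq> H \<inter> G'"
    proof
      assume "H \<inter> G \<subseteq> H \<inter> G'"
      then have "H \<inter> G \<subset> H \<inter> G'" using z G' by blast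
      then have "card (H \<inter> G) < card (H \<inter> G')" by (intro psubset_card_mono) auto
      then show False using G(2)[OF G'(1)] by simp
    qed
    then obtain y where y: "y \<in> H \<inter> G" "y \<notin> G'" by blast
    show False
      by (rule no_special_triangle[OF forest, of G G' H x y z])
        (use T H G(1) G' x xH y z in auto)
  qed
qed

section \<open>The inequalities for simplicial trees\<close>

theorem corollary4p4:
  fixes \<Delta> :: "'v::finite set set"
    and F :: "nat \<Rightarrow> 'v set"
    and D :: "nat \<Rightarrow> 'v set set"
    and a :: "nat \<Rightarrow> nat"
    and q s :: nat
  assumes complex: "simplicial_complex_on UNIV \<Delta>"
    and tree: "simplicial_tree \<Delta>"
    and facets: "bij_betw F {0..q} (facets \<Delta>)"
    and a_first: "a 0 = 0"
    and a_last: "a (Suc s) = q + 1"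
    and a_less: "\<And>i. i \<le> s \<Longrightarrow> a i < a (Suc i)"
    and D_subcollection: "\<And>i. i \<le> s \<Longrightarrow> subcollection (D i) \<Delta>"
    and D_tree: "\<And>i. i \<le> s \<Longrightarrow> simplicial_tree (D i)"
    and D_generated: "\<And>i. i \<le> s \<Longrightarrow> D i = generated_complex (F ` {a i..<a (Suc i)})"
    and D_good_leaf: "\<And>i. i \<le> s \<Longrightarrow> good_leaf (F (a i)) (D i)"
    and D_order: "\<And>i. i \<le> s \<Longrightarrow> good_leaf_order (map F [a i..<a (Suc i)]) (D i)"
    and D_chain: "\<And>i j l. i \<le> s \<Longrightarrow> a i < j \<Longrightarrow> j \<le> l \<Longrightarrow> l < a (Suc i) \<Longrightarrow>
                    F l \<inter> F (a i) \<subseteq> F j \<inter> F (a i)"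
    and D_chain_last: "\<And>i. i \<le> s \<Longrightarrow> F (a (Suc i) - 1) \<inter> F (a i) \<noteq> {}"
    and D_disjoint: "\<And>i j. i \<le> s \<Longrightarrow> a (Suc i) \<le> j \<Longrightarrow> j \<le> q \<Longrightarrow> F (a i) \<inter> F j = {}"
  shows "(\<forall>i j. betti (facet_ideal TYPE('k::field) \<Delta>) i j
                 \<ge> (\<Sum>t=0..s. betti (facet_ideal TYPE('k) (D t)) i j)) \<and>
         projdim (facet_ideal TYPE('k) \<Delta>)
           \<ge> Max ((\<lambda>t. projdim (facet_ideal TYPE('k) (D t))) ` {0..s}) \<and>
         reg (facet_ideal TYPE('k) \<Delta>)
           \<ge> Max ((\<lambda>t. reg (facet_ideal TYPE('k) (D t))) ` {0..s})"
proof -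
  define T where "T t = F ` {a t..<a (Suc t)}" for t
  let ?S = "facets \<Delta>"
  have forest: "simplicial_forest \<Delta>" using tree by (simp add: simplicial_tree_def)
  have antichain: "A = B" if "A \<in> ?S" "B \<in> ?S" "A \<subseteq> B" for A B
    using that unfolding facets_def by blast
  \<comment> \<open>A type is nonempty, so there is a vertex, whose singleton is a face properly
    containing the empty set.\<close>
  have "{} \<notin> ?S"
  proof
    fix v assume "{} \<in> ?S"
    moreover have "{v} \<in> \<Delta>" using complex by (simp add: simplicial_complex_on_def)
    ultimately show False unfolding facets_def by blast
  qed
  then have S: "clutter ?S" using antichain unfolding clutter_def by blast
  have a_mono: "a i \<le> a j" if "i \<le> j" "j \<le> Suc s" for i j
    using that
  proof (induction j rule: dec_induct)
    case (step n)
    then show ?case using a_less[of n] by simp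
  qed simp
  have a_le: "k \<le> q" if "t \<le> s" "k < a (Suc t)" for t k
    using a_mono[of "Suc t" "Suc s"] that a_last by simp
  have F_in: "F k \<in> ?S" if "k \<le> q" for k using facets that by (auto simp: bij_betw_def)
  have F_inj: "k = k'" if "F k = F k'" "k \<le> q" "k' \<le> q" for k k'
    using facets that by (auto simp: bij_betw_def inj_on_def)
  have T_sub: "T t \<subseteq> ?S" if "t \<le> s" for t using a_le[OF that] F_in by (auto simp: T_def)
  have facets_D: "facets (D t) = T t" if "t \<le> s" for t
    unfolding D_generated[OF that] T_def[symmetric]
    by (rule facets_generated_complex) (use antichain T_sub[OF that] in blast)
  \<comment> \<open>Intersections with \<open>F (a t)\<close> decrease along the order, so the last
    one lies in every later facet of the piece; in \<open>F (a t)\<close> itself it lies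
    trivially.\<close>
  have center: "F (a (Suc t) - 1) \<inter> F (a t) \<subseteq> G" if t: "t \<le> s" and G: "G \<in> T t" for t G
  proof -
    obtain k where k: "a t \<le> k" "k < a (Suc t)" "G = F k" using G by (auto simp: T_def)
    then show ?thesis using D_chain[OF t, of k "a (Suc t) - 1"] by (cases "k = a t") auto
  qed
  \<comment> \<open>The intervals exhaust all indices because \<open>a\<close> runs from 0 to
    \<open>q + 1\<close>.\<close>
  have block: "\<exists>u\<le>s. a u \<le> k \<and> k < a (Suc u)" if k: "k \<le> q" for k
  proof -
    have "\<exists>u<n. a u \<le> k \<and> k < a (Suc u)" if "k < a n" for n
      using that
    proof (induction n)
      case 0 then show ?case using a_first by simp
    next
      case (Suc n)
      show ?case
      proof (cases "k < a n")
        case True then show ?thesis using Suc.IH less_SucI by blast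
      next
        case False then show ?thesis using Suc.prems by (intro exI[of _ n]) simp
      qed
    qed
    from this[of "Suc s"] show ?thesis using k a_last by (simp add: less_Suc_eq_le)
  qed
  have disj: "T t \<inter> T u = {}" if tu: "t \<le> s" "u \<le> s" "t < u" for t u
  proof (rule ccontr)
    assume "T t \<inter> T u \<noteq> {}"
    then obtain k k' where k: "k < a (Suc t)" "a u \<le> k'" "k' < a (Suc u)" "F k = F k'"
      by (auto simp: T_def)
    then have "k = k'" using F_inj a_le tu by blast
    then show False using k a_mono[of "Suc t" u] tu by simp
  qed
  have superadditive: "(\<Sum>t\<in>{0..s}. clutter_betti TYPE('k) (T t) i j) \<le> clutter_betti TYPE('k) ?S i j" for i j
  proof (rule clutter_betti_superadditive[OF S])
    show "T t \<subseteq> ?S" if "t \<in> {0..s}" for t using T_sub that by simp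
    show "T t \<inter> T u = {}" if "t \<in> {0..s}" "u \<in> {0..s}" "t \<noteq> u" for t u
      using disj[of t u] disj[of u t] that by (cases t u rule: linorder_cases) auto
    show "{H \<in> ?S. H \<subseteq> W} \<subseteq> T t" if "t \<in> {0..s}" and ne: "W \<noteq> {}" and W: "W = \<Union>{G \<in> T t. G \<subseteq> W}" for t W
    proof
      have t: "t \<le> s" using that by simp
      fix H assume "H \<in> {H \<in> ?S. H \<subseteq> W}"
      then have H: "H \<in> ?S" "H \<subseteq> W" by auto
      have "H \<in> F ` {0..q}" using facets H(1) by (simp add: bij_betw_def)
      then obtain k where k: "k \<le> q" "H = F k" by auto
      obtain u where u: "u \<le> s" "a u \<le> k" "k < a (Suc u)" using block[OF k(1)] by blast
      then have HT: "H \<in> T u" unfolding T_def k(2) by auto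
      consider "u < t" | "u = t" | "t < u" by linarith
      then show "H \<in> T t"
      proof cases
        case 1
        \<comment> \<open>The center of the earlier piece \<open>T u\<close> lies in
          \<open>H\<close>, so \<open>x\<close> is in \<open>W\<close> and in a facet of
          \<open>T t\<close>. But \<open>F (a u)\<close> contains \<open>x\<close> and misses all
          later pieces.\<close>
        obtain x where x: "x \<in> F (a (Suc u) - 1) \<inter> F (a u)" using D_chain_last[OF u(1)] by blast
        then have "x \<in> W" using center[OF u(1) HT] H(2) by blast
        then obtain k' where k': "a t \<le> k'" "k' < a (Suc t)" "x \<in> F k'"
          using W unfolding T_def by fastforce
        have "a (Suc u) \<le> k'" using a_mono[of "Suc u" t] 1 t k'(1) by simp
        then show ?thesis using D_disjoint[OF u(1) _ a_le[OF t k'(2)]] x k'(3) by blast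
      next
        case 2
        then show ?thesis using HT by simp
      next
        case 3
        \<comment> \<open>\<open>H\<close> is covered by facets through \<open>x\<close>, so it
          contains \<open>x\<close> too, against its disjointness from
          \<open>F (a t)\<close>.\<close>
        obtain x where x: "x \<in> F (a (Suc t) - 1) \<inter> F (a t)" using D_chain_last[OF t] by blast
        have "x \<in> H"
        proof (rule covered_facet_meets_center[OF forest])
          show "{G \<in> T t. G \<subseteq> W} \<subseteq> ?S" using T_sub[OF t] by blast
          show "{G \<in> T t. G \<subseteq> W} \<noteq> {}" using W ne by blast
          show "H \<subseteq> \<Union>{G \<in> T t. G \<subseteq> W}" using H(2) W by simp
          show "x \<in> G" if "G \<in> {G \<in> T t. G \<subseteq> W}" for G using center[OF t, of G] x that by blast
        qed (rule H(1))
        moreover have "a (Suc t) \<le> k" using a_mono[of "Suc t" u] 3 u by simp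
        then have "F (a t) \<inter> F k = {}" using D_disjoint[OF t _ k(1)] by blast
        ultimately show ?thesis using x k(2) by blast
      qed
    qed
  qed simp
  let ?b = "clutter_betti TYPE('k)"
  have le: "?b (T t) i j \<le> ?b ?S i j" if "t \<le> s" for t i j
  proof -
    have "?b (T t) i j \<le> (\<Sum>t\<in>{0..s}. ?b (T t) i j)" by (rule member_le_sum) (use that in auto)
    then show ?thesis using superadditive[of i j] by simp
  qed
  have ex: "\<exists>j. ?b (T t) 0 j \<noteq> 0" if t: "t \<le> s" for t
  proof -
    have "clutter (T t)" by (rule clutter_subset[OF T_sub[OF t] S])
    moreover have "F (a t) \<in> T t" using a_less[OF t] by (simp add: T_def)
    ultimately show ?thesis using clutter_betti_0_nonzero by blast
  qed
  \<comment> \<open>Comparing maxima by inclusion needs the larger set finite and the smaller one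
    nonempty; the latter is \<open>ex\<close>.\<close>
  have fin_pd: "finite {i. \<exists>j. ?b ?S i j \<noteq> 0}"
    by (rule finite_subset[of _ "{..card (UNIV :: 'v set)}"]) (use clutter_betti_bounded[OF S] in auto)
  have "finite ((\<lambda>(i, j). int j - int i) ` ({..card (UNIV :: 'v set)} \<times> {..card (UNIV :: 'v set)}))" by simp
  then have fin_reg: "finite {int j - int i | i j. ?b ?S i j \<noteq> 0}"
  proof (rule rev_finite_subset, intro subsetI)
    fix m assume "m \<in> {int j - int i | i j. ?b ?S i j \<noteq> 0}"
    then obtain i j where ij: "m = int j - int i" "?b ?S i j \<noteq> 0" by blast
    show "m \<in> (\<lambda>(i, j). int j - int i) ` ({..card (UNIV :: 'v set)} \<times> {..card (UNIV :: 'v set)})"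
      by (rule image_eqI[of _ _ "(i, j)"]) (use ij clutter_betti_bounded[OF S ij(2)] in simp_all)
  qed
  have pd: "projdim (facet_ideal TYPE('k) (D t)) \<le> projdim (facet_ideal TYPE('k) \<Delta>)" if t: "t \<le> s" for t
    unfolding projdim_def betti_facet_ideal facets_D[OF t]
  proof (rule Max_mono[OF _ _ fin_pd])
    show "{i. \<exists>j. ?b (T t) i j \<noteq> 0} \<subseteq> {i. \<exists>j. ?b ?S i j \<noteq> 0}"
    proof
      fix i assume "i \<in> {i. \<exists>j. ?b (T t) i j \<noteq> 0}"
      then obtain j where "?b (T t) i j \<noteq> 0" by blast
      then have "?b ?S i j \<noteq> 0" using le[OF t, of i j] by linarith
      then show "i \<in> {i. \<exists>j. ?b ?S i j \<noteq> 0}" by blast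
    qed
    show "{i. \<exists>j. ?b (T t) i j \<noteq> 0} \<noteq> {}" using ex[OF t] by blast
  qed
  have rg: "reg (facet_ideal TYPE('k) (D t)) \<le> reg (facet_ideal TYPE('k) \<Delta>)" if t: "t \<le> s" for t
    unfolding reg_def betti_facet_ideal facets_D[OF t]
  proof (rule Max_mono[OF _ _ fin_reg])
    show "{int j - int i | i j. ?b (T t) i j \<noteq> 0} \<subseteq> {int j - int i | i j. ?b ?S i j \<noteq> 0}"
    proof
      fix m assume "m \<in> {int j - int i | i j. ?b (T t) i j \<noteq> 0}"
      then obtain i j where "m = int j - int i" "?b (T t) i j \<noteq> 0" by blast
      moreover from this have "?b ?S i j \<noteq> 0" using le[OF t, of i j] by linarith
      ultimately show "m \<in> {int j - int i | i j. ?b ?S i j \<noteq> 0}" by blast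
    qed
    show "{int j - int i | i j. ?b (T t) i j \<noteq> 0} \<noteq> {}" using ex[OF t] by blast
  qed
  show ?thesis
  proof (intro conjI allI)
    fix i j
    have "(\<Sum>t = 0..s. betti (facet_ideal TYPE('k) (D t)) i j) = (\<Sum>t = 0..s. ?b (T t) i j)"
      by (rule sum.cong) (simp_all add: betti_facet_ideal facets_D)
    then show "(\<Sum>t = 0..s. betti (facet_ideal TYPE('k) (D t)) i j) \<le> betti (facet_ideal TYPE('k) \<Delta>) i j"
      using superadditive[of i j] by (simp add: betti_facet_ideal)
  next
    show "Max ((\<lambda>t. projdim (facet_ideal TYPE('k) (D t))) ` {0..s}) \<le> projdim (facet_ideal TYPE('k) \<Delta>)"
      using pd by (subst Max_le_iff) auto
    show "Max ((\<lambda>t. reg (facet_ideal TYPE('k) (D t))) ` {0..s}) \<le> reg (facet_ideal TYPE('k) \<Delta>)"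
      using rg by (subst Max_le_iff) auto
  qed
qed

end
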